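(* Under the Setup and the Unconditional asymptotic regime described in the context, for $i,j\in\{0,1\}$ the following three limits exist and are equal: $$\lim_{p\to\infty}E_{\boldsymbol\mu,S_n}[\hat\varepsilon_i^B\varepsilon_j]=\lim_{p\to\infty}E_{\boldsymbol\mu,S_n}[\hat\varepsilon_i^B\hat\varepsilon_j^B]=\lim_{p\to\infty}E_{\boldsymbol\mu,S_n}[\varepsilon_i\varepsilon_j]=\Phi\!\left((-1)^i\frac{-H_i+c}{\sqrt F}\right)\Phi\!\left((-1)^j\frac{-H_j+c}{\sqrt F}\right).$$ Consequently $$\lim_{p\to\infty}E_{\boldsymbol\mu,S_n}[\hat\varepsilon^B\varepsilon]=\sum_{i=0}^1\sum_{j=0}^1\alpha_i\alpha_j\,\Phi\!\left((-1)^i\frac{-H_i+c}{\sqrt F}\right)\Phi\!\left((-1)^j\frac{-H_j+c}{\sqrt F}\right),$$ where $H_0=\frac12\big(\bar\Delta^2_{\mathbf m}+J_1-J_0+\frac{J_0}{\gamma_0}+\frac{J_1}{\gamma_1}\big)$, $H_1=-\frac12\big(\bar\Delta^2_{\mathbf m}+J_0-J_1+\frac{J_0}{\gamma_0}+\frac{J_1}{\gamma_1}\big)$, and $F=\bar\Delta^2_{\mathbf m}+J_0+J_1+\frac{J_0}{\gamma_0}+\frac{J_1}{\gamma_1}$.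
   Context: Setup. Fix $\alpha_0\in(0,1)$, $\alpha_1=1-\alpha_0$, and $c=\log\frac{1-\alpha_0}{\alpha_0}$. $\Phi$ is the standard normal CDF. For each dimension $p$ there is a known symmetric positive definite $p\times p$ matrix $\Sigma$, sample sizes $n_0,n_1$, prior means $\mathbf m_0,\mathbf m_1\in\mathbb R^p$ and prior certainty parameters $\nu_0,\nu_1>0$ (all depending on $p$; the index $p$ is suppressed). The class means are random: $\boldsymbol\mu_i\sim N(\mathbf m_i,\Sigma/\nu_i)$, $i=0,1$, independent; $\boldsymbol\mu=(\boldsymbol\mu_0,\boldsymbol\mu_1)$. Given $\boldsymbol\mu$, class $i$ has distribution $\Pi_i=N(\boldsymbol\mu_i,\Sigma)$, and the sample $S_n$ consists of $n_0$ i.i.d. points from $\Pi_0$ and, independently, $n_1$ i.i.d. points from $\Pi_1$; $\bar{\mathbf x}_0,\bar{\mathbf x}_1$ are the class sample means. The LDA classifier assigns $\mathbf x$ to class 1 if $W(\mathbf x)\le c$ and to class 0 otherwise, where $W(\mathbf x)=(\mathbf x-\frac{\bar{\mathbf x}_0+\bar{\mathbf x}_1}{2})^T\Sigma^{-1}(\bar{\mathbf x}_0-\bar{\mathbf x}_1)$. Let $\hat\delta^2=(\bar{\mathbf x}_0-\bar{\mathbf x}_1)^T\Sigma^{-1}(\bar{\mathbf x}_0-\bar{\mathbf x}_1)$. The true error is $\varepsilon=\alpha_0\varepsilon_0+\alpha_1\varepsilon_1$ with $\varepsilon_i=\Phi\Big(\frac{(-1)^{i+1}(\boldsymbol\mu_i-\frac{\bar{\mathbf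 x}_0+\bar{\mathbf x}_1}{2})^T\Sigma^{-1}(\bar{\mathbf x}_0-\bar{\mathbf x}_1)+(-1)^i c}{\hat\delta}\Big)$. The Bayesian MMSE error estimator is $\hat\varepsilon^B=\alpha_0\hat\varepsilon^B_0+\alpha_1\hat\varepsilon^B_1$ with $\hat\varepsilon_i^B=\Phi\Big((-1)^i\frac{-(\mathbf m_i^*-\frac{\bar{\mathbf x}_0+\bar{\mathbf x}_1}{2})^T\Sigma^{-1}(\bar{\mathbf x}_0-\bar{\mathbf x}_1)+c}{\hat\delta}\sqrt{\frac{\nu_i^*}{\nu_i^*+1}}\Big)$, where $\mathbf m_i^*=\frac{n_i\bar{\mathbf x}_i+\nu_i\mathbf m_i}{n_i+\nu_i}$ and $\nu_i^*=n_i+\nu_i$. Notation: $\Delta^2_{\mathbf m}=(\mathbf m_0-\mathbf m_1)^T\Sigma^{-1}(\mathbf m_0-\mathbf m_1)$, and $\bar\Delta^2_{\mathbf m}$ its limit as $p\to\infty$. Unconditional asymptotic regime. Expectations $E_{\boldsymbol\mu,S_n}$ are over both $\boldsymbol\mu$ and the sample. As $p\to\infty$: $n_0,n_1,\nu_0,\nu_1\to\infty$, $p/n_i\to J_i\in[0,\infty)$, $\nu_i/n_i\to\gamma_i\in(0,\infty)$, and for all $i,j\in\{0,1\}$, $\mathbf m_i^T\Sigma^{-1}\mathbf m_j$ converges to a finite limit. It is assumed that $F>0$ (with $F$ as in the claim). $\lim_{p\to\infty}$ denotes the limit along this regime. *)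

theory Defs
  imports "HOL-Probability.Probability"
begin

text \<open>Vectors in R^p are functions nat => real read on indices < p;
  p x p matrices are functions nat => nat => real read on indices < p.\<close>

definition Phi :: "real \<Rightarrow> real" where
  "Phi x = (LBINT t:{..x}. std_normal_density t)"

definition bil :: "nat \<Rightarrow> (nat \<Rightarrow> nat \<Rightarrow> real) \<Rightarrow> (nat \<Rightarrow> real) \<Rightarrow> (nat \<Rightarrow> real) \<Rightarrow> real" where
  "bil p A x y = (\<Sum>i<p. \<Sum>j<p. x i * A i j * y j)"

definition sym_pd :: "nat \<Rightarrow> (nat \<Rightarrow> nat \<Rightarrow> real) \<Rightarrow> bool" where
  "sym_pd p A \<longleftrightarrow> (\<forall>i<p. \<forall>j<p. A i j = A j i) \<and>
     (\<forall>x. (\<exists>i<p. x i \<noteq> 0) \<longrightarrow> bil p A x x > 0)"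

definition is_inverse :: "nat \<Rightarrow> (nat \<Rightarrow> nat \<Rightarrow> real) \<Rightarrow> (nat \<Rightarrow> nat \<Rightarrow> real) \<Rightarrow> bool" where
  "is_inverse p A B \<longleftrightarrow> (\<forall>i<p. \<forall>j<p. (\<Sum>k<p. A i k * B k j) = (if i = j then 1 else 0))"

definition mat_inv :: "nat \<Rightarrow> (nat \<Rightarrow> nat \<Rightarrow> real) \<Rightarrow> (nat \<Rightarrow> nat \<Rightarrow> real)" where
  "mat_inv p A = (SOME B. is_inverse p A B)"

definition det_p :: "nat \<Rightarrow> (nat \<Rightarrow> nat \<Rightarrow> real) \<Rightarrow> real" where
  "det_p p A = (\<Sum>\<pi> \<in> {\<pi>. \<pi> permutes {..<p}}. of_int (sign \<pi>) * (\<Prod>i<p. A i (\<pi> i)))"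

definition gauss_density :: "nat \<Rightarrow> (nat \<Rightarrow> real) \<Rightarrow> (nat \<Rightarrow> nat \<Rightarrow> real) \<Rightarrow> (nat \<Rightarrow> real) \<Rightarrow> real" where
  "gauss_density p m S x =
     exp (- bil p (mat_inv p S) (\<lambda>i. x i - m i) (\<lambda>i. x i - m i) / 2)
     / sqrt ((2 * pi) ^ p * det_p p S)"

definition mvn :: "nat \<Rightarrow> (nat \<Rightarrow> real) \<Rightarrow> (nat \<Rightarrow> nat \<Rightarrow> real) \<Rightarrow> (nat \<Rightarrow> real) measure" where
  "mvn p m S = density (PiM {..<p} (\<lambda>_. lborel)) (\<lambda>x. ennreal (gauss_density p m S x))"

definition scale_mat :: "real \<Rightarrow> (nat \<Rightarrow> nat \<Rightarrow> real) \<Rightarrow> (nat \<Rightarrow> nat \<Rightarrow> real)" where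
  "scale_mat a A = (\<lambda>i j. a * A i j)"

definition sample_mean :: "nat \<Rightarrow> (nat \<Rightarrow> nat \<Rightarrow> real) \<Rightarrow> (nat \<Rightarrow> real)" where
  "sample_mean n X = (\<lambda>i. (\<Sum>k<n. X k i) / real n)"

text \<open>True class-i error eps_i of LDA, given the class mean mu_i and sample means xb0, xb1.\<close>
definition true_err :: "nat \<Rightarrow> (nat \<Rightarrow> nat \<Rightarrow> real) \<Rightarrow> real \<Rightarrow> nat \<Rightarrow>
    (nat \<Rightarrow> real) \<Rightarrow> (nat \<Rightarrow> real) \<Rightarrow> (nat \<Rightarrow> real) \<Rightarrow> real" where
  "true_err p Sinv c i mu xb0 xb1 =
     (let d = (\<lambda>k. xb0 k - xb1 k); mid = (\<lambda>k. (xb0 k + xb1 k) / 2) in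
      Phi (((-1) ^ (i + 1) * bil p Sinv (\<lambda>k. mu k - mid k) d + (-1) ^ i * c) / sqrt (bil p Sinv d d)))"

text \<open>Bayesian MMSE error estimator for class i (prior mean m, prior certainty nu, sample size n).\<close>
definition bayes_err :: "nat \<Rightarrow> (nat \<Rightarrow> nat \<Rightarrow> real) \<Rightarrow> real \<Rightarrow> nat \<Rightarrow> nat \<Rightarrow> real \<Rightarrow>
    (nat \<Rightarrow> real) \<Rightarrow> (nat \<Rightarrow> real) \<Rightarrow> (nat \<Rightarrow> real) \<Rightarrow> real" where
  "bayes_err p Sinv c i n nu m xb0 xb1 =
     (let d = (\<lambda>k. xb0 k - xb1 k); mid = (\<lambda>k. (xb0 k + xb1 k) / 2);
          xbi = (if i = 0 then xb0 else xb1);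
          mstar = (\<lambda>k. (real n * xbi k + nu * m k) / (real n + nu));
          nustar = real n + nu in
      Phi ((-1) ^ i * (- bil p Sinv (\<lambda>k. mstar k - mid k) d + c) / sqrt (bil p Sinv d d)
           * sqrt (nustar / (nustar + 1))))"

text \<open>Joint expectation over mu_0 ~ N(m_0, S/nu_0), mu_1 ~ N(m_1, S/nu_1) and the samples
  (n_0 iid points from N(mu_0,S), n_1 iid points from N(mu_1,S)), written as an iterated
  integral; g receives mu_0, mu_1 and the two sample means.\<close>
definition joint_exp :: "nat \<Rightarrow> (nat \<Rightarrow> nat \<Rightarrow> real) \<Rightarrow> (nat \<Rightarrow> nat) \<Rightarrow> (nat \<Rightarrow> real) \<Rightarrow>
    (nat \<Rightarrow> nat \<Rightarrow> real) \<Rightarrow>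
    ((nat \<Rightarrow> real) \<Rightarrow> (nat \<Rightarrow> real) \<Rightarrow> (nat \<Rightarrow> real) \<Rightarrow> (nat \<Rightarrow> real) \<Rightarrow> real) \<Rightarrow> real" where
  "joint_exp p S n nu m g =
     (\<integral>mu0. (\<integral>mu1. (\<integral>X0. (\<integral>X1. g mu0 mu1 (sample_mean (n 0) X0) (sample_mean (n 1) X1)
        \<partial>(PiM {..<n 1} (\<lambda>_. mvn p mu1 S)))
        \<partial>(PiM {..<n 0} (\<lambda>_. mvn p mu0 S)))
        \<partial>(mvn p (m 1) (scale_mat (1 / nu 1) S)))
        \<partial>(mvn p (m 0) (scale_mat (1 / nu 0) S)))"

end

theory Submission
  imports Defs "Jordan_Normal_Form.Determinant"
begin

text \<open>
  Take K with K S K^T = I. Applying K to the mean and sample increments mu_i - m_i and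
  xbar_i - mu_i turns them into independent Gaussian vectors a_i, b_i with covariances I / nu_i and
  I / n_i, and turns the forms x^T S^{-1} y into inner products. With u = K (m_0 - m_1), every error
  and every estimator becomes a fixed continuous function of the inner products of the five vectors
  u, a_0, a_1, b_0, b_1. By second moment bounds the squared norms converge in probability to Dbar,
  J_i / gam_i and J_i, while all mixed inner products converge to 0. Hence each error converges in
  probability to a constant, and since the errors are bounded, the expected products converge to the
  products of these constants.
\<close>

section \<open>Whitening a positive definite matrix\<close>

text \<open>The obstacle is that \<open>joint_exp\<close> is a nested integral whose inner measures
  have outer variables as their means. Whitening increments instead of the vectors themselves
  removes this dependence: the law of K (xbar_i - mu_i) is the same for every mu_i, so the nested
  integral becomes an integral over one product measure. Mixed inner products vanish because their
  mean squares are |u|^2 / k or p / (k k') with precisions k, k': the ratios p / k converge while k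
  itself tends to infinity. Errors and estimators share a limit for an arithmetic reason: the weight
  n_i / (n_i + nu_i) of the sample mean in the posterior mean tends to t_i = 1 / (1 + gam_i), and
  t_i (J_i / gam_i + J_i) = J_i / gam_i, so the posterior mean and mu_i contribute equally in the
  limit; the extra factor under the root tends to 1. The assumption F > 0 keeps the limit of the
  denominator away from 0, so that the quotient inside \<open>Phi\<close> converges.\<close>

text \<open>Triangularity lets the change of variables below proceed one coordinate at a time.\<close>

definition lower_tri :: "nat \<Rightarrow> (nat \<Rightarrow> nat \<Rightarrow> real) \<Rightarrow> bool" where
  "lower_tri p K \<longleftrightarrow> (\<forall>i<p. 0 < K i i \<and> (\<forall>j. i < j \<longrightarrow> K i j = 0))"

definition whitens :: "nat \<Rightarrow> (nat \<Rightarrow> nat \<Rightarrow> real) \<Rightarrow> (nat \<Rightarrow> nat \<Rightarrow> real) \<Rightarrow> bool" where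
  "whitens p K S \<longleftrightarrow> (\<forall>i<p. \<forall>j<p. bil p S (K i) (K j) = (if i = j then 1 else 0))"

definition dot :: "nat \<Rightarrow> (nat \<Rightarrow> real) \<Rightarrow> (nat \<Rightarrow> real) \<Rightarrow> real" where
  "dot p x y = (\<Sum>i<p. x i * y i)"

lemma bil_add_left: "bil p A (\<lambda>k. x k + y k) z = bil p A x z + bil p A y z"
  by (simp add: bil_def algebra_simps sum.distrib)

lemma bil_diff_left: "bil p A (\<lambda>k. x k - y k) z = bil p A x z - bil p A y z"
  by (simp add: bil_def algebra_simps sum_subtractf)

lemma bil_diff_right: "bil p A x (\<lambda>k. y k - z k) = bil p A x y - bil p A x z"
  by (simp add: bil_def algebra_simps sum_subtractf)

lemma bil_scale_left: "bil p A (\<lambda>k. c * x k) y = c * bil p A x y"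
  by (simp add: bil_def sum_distrib_left mult_ac)

lemma bil_scale_right: "bil p A x (\<lambda>k. c * y k) = c * bil p A x y"
  by (simp add: bil_def sum_distrib_left mult_ac)

lemma bil_sum_left:
  fixes q :: nat
  shows "bil p A (\<lambda>k. \<Sum>l<q. c l * x l k) y = (\<Sum>l<q. c l * bil p A (x l) y)"
proof (induction q)
  case 0
  show ?case by (simp add: bil_def)
next
  case (Suc q)
  then show ?case by (simp add: bil_add_left bil_scale_left)
qed

lemma bil_commute:
  assumes "sym_pd p A"
  shows "bil p A x y = bil p A y x"
proof -
  have "bil p A x y = (\<Sum>j<p. \<Sum>i<p. x i * A i j * y j)"
    unfolding bil_def by (rule sum.swap)
  also have "\<dots> = bil p A y x"
    unfolding bil_def using assms by (intro sum.cong refl) (auto simp: sym_pd_def)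
  finally show ?thesis .
qed

text \<open>Orthonormalisation of the standard basis, in its natural order, for the inner product
  x^T S y. Row i involves only basis vectors up to i, which is the source of the triangular
  shape.\<close>

lemma gram_schmidt:
  assumes S: "sym_pd p S" and "q \<le> p"
  shows "\<exists>K. (\<forall>i<q. 0 < K i i \<and> (\<forall>j. i < j \<longrightarrow> K i j = 0)) \<and>
             (\<forall>i<q. \<forall>j<q. bil p S (K i) (K j) = (if i = j then 1 else 0))"
  using \<open>q \<le> p\<close>
proof (induction q)
  case 0
  show ?case by simp
next
  case (Suc q)
  then obtain K where K: "\<And>i. i < q \<Longrightarrow> 0 < K i i" "\<And>i j. i < q \<Longrightarrow> i < j \<Longrightarrow> K i j = 0"
    and orth: "\<And>i j. i < q \<Longrightarrow> j < q \<Longrightarrow> bil p S (K i) (K j) = (if i = j then 1 else 0)"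
    by (metis Suc_leD)
  \<comment> \<open>The earlier rows vanish in coordinate q, so subtracting multiples of them from
    the q-th basis vector leaves \<open>f q = 1\<close>. This makes f nonzero, hence of positive
    norm, and turns the new diagonal entry into 1 / r.\<close>
  define e where "e = (\<lambda>k. if k = q then 1 else (0::real))"
  define f where "f = (\<lambda>k. e k - (\<Sum>l<q. bil p S e (K l) * K l k))"
  have fq: "f q = 1" "f j = 0" if "q < j" for j
    using that K(2) by (auto simp: f_def e_def intro!: sum.neutral)
  have fq1: "f q = 1" using fq(1)[of "Suc q"] by simp
  have orth_f: "bil p S f (K j) = 0" if "j < q" for j
  proof -
    have "(\<Sum>l<q. bil p S e (K l) * bil p S (K l) (K j)) = (\<Sum>l<q. if l = j then bil p S e (K l) else 0)"
      using that orth by (intro sum.cong) auto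
    then show ?thesis
      using that by (simp add: f_def bil_diff_left bil_sum_left)
  qed
  define r where "r = sqrt (bil p S f f)"
  have ff: "bil p S f f > 0"
  proof -
    have "\<exists>i<p. f i \<noteq> 0" using Suc.prems fq1 by (intro exI[of _ q]) auto
    then show ?thesis using S unfolding sym_pd_def by blast
  qed
  then have r: "r > 0" "r * r = bil p S f f" "1 / r * (1 / r * (r * r)) = 1"
    by (simp_all add: r_def)
  define K' where "K' = K(q := \<lambda>k. (1 / r) * f k)"
  have "0 < K' i i \<and> (\<forall>j. i < j \<longrightarrow> K' i j = 0)" if "i < Suc q" for i
    using that K fq fq1 r unfolding K'_def by (auto simp: less_Suc_eq)
  moreover have "bil p S (K' i) (K' j) = (if i = j then 1 else 0)" if "i < Suc q" "j < Suc q" for i j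
  proof -
    have "bil p S (K j) f = 0" if "j < q" for j
      using orth_f[OF that] bil_commute[OF S] by metis
    then show ?thesis
      using that orth orth_f r(1)
      by (auto simp: K'_def less_Suc_eq bil_scale_left bil_scale_right r(2)[symmetric] r(3)
               simp del: times_divide_eq_left)
  qed
  ultimately show ?case by blast
qed

corollary ex_whitening:
  assumes "sym_pd p S"
  obtains K where "lower_tri p K" "whitens p K S"
  using gram_schmidt[OF assms order.refl] unfolding lower_tri_def whitens_def by blast

context
  fixes p :: nat and K S :: "nat \<Rightarrow> nat \<Rightarrow> real"
  assumes lower_tri: "lower_tri p K" and wh: "whitens p K S"
begin

lemma prod_diag_pos: "0 < (\<Prod>i<p. K i i)"
  using lower_tri by (intro prod_pos) (auto simp: lower_tri_def)

private abbreviation "Km \<equiv> mat p p (\<lambda>(i,j). K i j)"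
private abbreviation "Sm \<equiv> mat p p (\<lambda>(i,j). S i j)"

private lemma KSK: "Km * (Sm * transpose_mat Km) = 1\<^sub>m p"
proof (rule eq_matI)
  fix i j assume "i < dim_row (1\<^sub>m p :: real mat)" "j < dim_col (1\<^sub>m p :: real mat)"
  then have ij: "i < p" "j < p" by auto
  have "(Km * (Sm * transpose_mat Km)) $$ (i, j) = (\<Sum>a<p. K i a * (\<Sum>b<p. S a b * K j b))"
    using ij by (simp add: scalar_prod_def atLeast0LessThan)
  also have "\<dots> = bil p S (K i) (K j)"
    by (simp add: bil_def sum_distrib_left mult_ac)
  finally show "(Km * (Sm * transpose_mat Km)) $$ (i, j) = 1\<^sub>m p $$ (i, j)"
    using ij wh by (simp add: whitens_def)
qed auto

text \<open>Taking determinants in K S K^T = I, where det K is the product of the diagonal. This is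
  what identifies the normalising constant of the Gaussian density.\<close>

lemma det_whitened: "det_p p S * (\<Prod>i<p. K i i)\<^sup>2 = 1"
proof -
  have [simp]: "Determinant.det Km = (\<Prod>i<p. K i i)"
  proof (subst det_lower_triangular)
    show "\<And>i j. i < j \<Longrightarrow> j < p \<Longrightarrow> Km $$ (i, j) = 0" using lower_tri by (auto simp: lower_tri_def)
    show "prod_list (diag_mat Km) = (\<Prod>i<p. K i i)"
      unfolding diag_mat_def 
      by (simp add: prod.distinct_set_conv_list[symmetric] atLeast0LessThan cong: map_cong)
  qed auto
  have "Determinant.det (Km * (Sm * transpose_mat Km)) = 1" using KSK by simp
  then have "(\<Prod>i<p. K i i) * (Determinant.det Sm * (\<Prod>i<p. K i i)) = 1"
    using det_mult[of Km p "Sm * transpose_mat Km"] mult_carrier_mat[of Sm p p "transpose_mat Km" p] det_mult[of Sm p "transpose_mat Km"]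
      det_transpose[of Km p] by simp
  moreover have "Determinant.det Sm = det_p p S"
    by (subst det_def'[of _ p])
       (auto simp: det_p_def atLeast0LessThan permutes_in_image intro!: sum.cong prod.cong)
  ultimately show ?thesis by (simp add: power2_eq_square mult_ac)
qed

text \<open>\<open>mat_inv\<close> chooses some right inverse, so its entries are known only through
  uniqueness: B = K^T K is a two-sided inverse of S, and any right inverse C satisfies C = (B S) C =
  B (S C) = B. The choice is determined only on indices below p.\<close>

lemma mat_inv_whitening:
  assumes ij: "i < p" "j < p"
  shows "mat_inv p S i j = (\<Sum>k<p. K k i * K k j)"
proof -
  let ?B = "transpose_mat Km * Km"
  have c: "Km \<in> carrier_mat p p" "Sm \<in> carrier_mat p p" "transpose_mat Km \<in> carrier_mat p p"
    "?B \<in> carrier_mat p p"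
    by auto
  \<comment> \<open>A one-sided inverse of a square matrix is two-sided, which allows K (S K^T) = I
    to be rotated into S (K^T K) = I.\<close>
  have "(Sm * transpose_mat Km) * Km = 1\<^sub>m p"
    by (rule mat_mult_left_right_inverse[OF c(1) _ KSK]) auto
  then have SB: "Sm * ?B = 1\<^sub>m p"
    using assoc_mult_mat[OF c(2) c(3) c(1)] by simp
  have BS: "?B * Sm = 1\<^sub>m p"
    by (rule mat_mult_left_right_inverse[OF c(2) c(4) SB])
  have inv_iff: "is_inverse p S C \<longleftrightarrow> Sm * mat p p (\<lambda>(i,j). C i j) = 1\<^sub>m p" for C
    unfolding is_inverse_def
    by (subst mat_eq_iff) (simp add: scalar_prod_def atLeast0LessThan)
  have "is_inverse p S (\<lambda>i j. ?B $$ (i,j))"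
    unfolding inv_iff by (subst SB[symmetric]) (rule arg_cong[where f="\<lambda>x. Sm * x"], rule eq_matI, auto)
  then have "is_inverse p S (mat_inv p S)"
    unfolding mat_inv_def by (rule someI[of "is_inverse p S"])
  then have inv: "Sm * mat p p (\<lambda>(i,j). mat_inv p S i j) = 1\<^sub>m p" (is "_ * ?C = _")
    unfolding inv_iff .
  have C: "?C \<in> carrier_mat p p" by simp
  have "?C = (?B * Sm) * ?C" unfolding BS by simp
  also have "\<dots> = ?B" using assoc_mult_mat[OF c(4) c(2) C] inv c(4) by simp
  finally have "?C $$ (i,j) = ?B $$ (i,j)" by simp
  then show ?thesis using ij by (simp add: scalar_prod_def atLeast0LessThan)
qed

lemma bil_mat_inv: 
  "bil p (mat_inv p S) x y = dot p (\<lambda>k. \<Sum>i<p. K k i * x i) (\<lambda>k. \<Sum>j<p. K k j * y j)"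
proof -
  have "bil p (mat_inv p S) x y = (\<Sum>i<p. \<Sum>j<p. \<Sum>k<p. (K k i * x i) * (K k j * y j))"
    unfolding bil_def
    by (intro sum.cong refl) (simp add: mat_inv_whitening sum_distrib_left sum_distrib_right mult_ac)
  also have "\<dots> = (\<Sum>i<p. \<Sum>k<p. \<Sum>j<p. (K k i * x i) * (K k j * y j))"
    by (intro sum.cong refl sum.swap)
  also have "\<dots> = (\<Sum>k<p. \<Sum>i<p. \<Sum>j<p. (K k i * x i) * (K k j * y j))"
    by (rule sum.swap)
  also have "\<dots> = dot p (\<lambda>k. \<Sum>i<p. K k i * x i) (\<lambda>k. \<Sum>j<p. K k j * y j)"
    by (simp add: dot_def sum_product)
  finally show ?thesis .
qed

end

lemma whitens_scale_mat:
  assumes "lower_tri p K" "whitens p K S" "0 < (r::real)"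
  shows "lower_tri p (\<lambda>i j. sqrt r * K i j)" "whitens p (\<lambda>i j. sqrt r * K i j) (scale_mat (1 / r) S)"
proof -
  have "bil p (scale_mat (1 / r) S) x y = bil p S x y / r" for x y
    by (simp add: bil_def scale_mat_def sum_divide_distrib)
  then show "whitens p (\<lambda>i j. sqrt r * K i j) (scale_mat (1 / r) S)"
    using assms by (simp add: whitens_def bil_scale_left bil_scale_right mult.assoc[symmetric])
qed (use assms in \<open>simp add: lower_tri_def\<close>)

section \<open>Whitened Gaussian vectors\<close>

text \<open>A finite product of probability measures is determined by its values on boxes, and there
  the integral of a product density factorises.\<close>

lemma PiM_lborel_density:
  fixes f :: "'i \<Rightarrow> real \<Rightarrow> real"
  assumes I: "finite I" and f[measurable]: "\<And>i. f i \<in> borel_measurable borel"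
    and f0: "\<And>i x. 0 \<le> f i x"
    and prob: "\<And>i. prob_space (density lborel (\<lambda>x. ennreal (f i x)))"
  shows "density (PiM I (\<lambda>_. lborel)) (\<lambda>x. ennreal (\<Prod>i\<in>I. f i (x i))) = PiM I (\<lambda>i. density lborel (\<lambda>x. ennreal (f i x)))"
proof -
  interpret L: product_sigma_finite "\<lambda>_::'i. lborel :: real measure"
    by standard
  interpret P: product_prob_space "\<lambda>i. density lborel (\<lambda>x. ennreal (f i x))"
    by (rule product_prob_spaceI) (rule prob)
  show ?thesis
  proof (rule P.PiM_eqI[OF I])
    show "sets (density (PiM I (\<lambda>_. lborel)) (\<lambda>x. ennreal (\<Prod>i\<in>I. f i (x i)))) =
          sets (PiM I (\<lambda>i. density lborel (\<lambda>x. ennreal (f i x))))"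
      by (simp cong: sets_PiM_cong)
    fix A assume A: "\<And>i. i \<in> I \<Longrightarrow> A i \<in> sets (density lborel (\<lambda>x. ennreal (f i x)))"
    then have A'[measurable]: "\<And>i. i \<in> I \<Longrightarrow> A i \<in> sets borel" by simp
    have "Pi\<^sub>E I A \<in> sets (PiM I (\<lambda>_. lborel))"
      using A' by (intro sets_PiM_I_finite[OF I]) auto
    then have "emeasure (density (PiM I (\<lambda>_. lborel)) (\<lambda>x. ennreal (\<Prod>i\<in>I. f i (x i)))) (Pi\<^sub>E I A)
      = (\<integral>\<^sup>+x. ennreal (\<Prod>i\<in>I. f i (x i)) * indicator (Pi\<^sub>E I A) x \<partial>PiM I (\<lambda>_. lborel))"
      by (intro emeasure_density) auto
    also have "\<dots> = (\<integral>\<^sup>+x. (\<Prod>i\<in>I. ennreal (f i (x i)) * indicator (A i) (x i)) \<partial>PiM I (\<lambda>_. lborel))"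
    proof (intro nn_integral_cong)
      fix x assume "x \<in> space (PiM I (\<lambda>_. lborel :: real measure))"
      then have "indicator (Pi\<^sub>E I A) x = (\<Prod>i\<in>I. indicator (A i) (x i) :: ennreal)"
        using I by (auto simp: indicator_def space_PiM PiE_iff prod_zero_iff)
      then show "ennreal (\<Prod>i\<in>I. f i (x i)) * indicator (Pi\<^sub>E I A) x =
         (\<Prod>i\<in>I. ennreal (f i (x i)) * indicator (A i) (x i))"
        using f0 by (simp add: prod.distrib prod_ennreal)
    qed
    also have "\<dots> = (\<Prod>i\<in>I. emeasure (density lborel (\<lambda>x. ennreal (f i x))) (A i))"
      using I by (subst L.product_nn_integral_prod) (auto simp: emeasure_density intro!: prod.cong)
    finally show "emeasure (density (PiM I (\<lambda>_. lborel)) (\<lambda>x. ennreal (\<Prod>i\<in>I. f i (x i)))) (Pi\<^sub>E I A) =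
       (\<Prod>i\<in>I. emeasure (density lborel (\<lambda>x. ennreal (f i x))) (A i))" .
  qed
qed

section \<open>Linear change of variables for triangular matrices\<close>

text \<open>Restricted to indices below p, so that the values lie in the product space.\<close>
definition mat_app :: "nat \<Rightarrow> (nat \<Rightarrow> nat \<Rightarrow> real) \<Rightarrow> (nat \<Rightarrow> real) \<Rightarrow> (nat \<Rightarrow> real)" where
  "mat_app p K x = (\<lambda>i\<in>{..<p}. \<Sum>j<p. K i j * x j)"

lemma mat_app_measurable [measurable]:
  assumes "\<And>j. j < p \<Longrightarrow> (\<lambda>w. x w j) \<in> borel_measurable M"
  shows "(\<lambda>w. mat_app p K (x w)) \<in> measurable M (PiM {..<p} (\<lambda>_. borel))"
  unfolding mat_app_def using assms by (intro measurable_restrict borel_measurable_sum borel_measurable_times) auto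

text \<open>The substitution y = K (x - t), whose Jacobian is the product of the diagonal. Because K
  is lower triangular, the first p coordinates of the image do not involve the last variable, and
  the last coordinate is affine in that variable once the others are fixed; so each induction step
  is a one-dimensional substitution.\<close>

lemma nn_integral_triangular:
  assumes "lower_tri p K" and f: "f \<in> borel_measurable (PiM {..<p} (\<lambda>_. borel))"
  shows "ennreal (\<Prod>i<p. K i i) * (\<integral>\<^sup>+x. f (mat_app p K (\<lambda>j. x j - t j)) \<partial>PiM {..<p} (\<lambda>_. lborel)) =
    (\<integral>\<^sup>+x. f x \<partial>PiM {..<p} (\<lambda>_. lborel))"
  using assms
proof (induction p arbitrary: f)
  case 0
  then show ?case by (simp add: mat_app_def PiM_empty nn_integral_count_space_finite restrict_def)
next
  case (Suc p)
  interpret L: product_sigma_finite "\<lambda>_::nat. lborel :: real measure" by standard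
  have [measurable_cong]: "sets (PiM I (\<lambda>_. lborel)) = sets (PiM I (\<lambda>_. borel :: real measure))" for I :: "nat set"
    by (simp cong: sets_PiM_cong)
  note f[measurable] = Suc.prems(2)
  have lower_tri: "lower_tri p K" "\<And>i. i < p \<Longrightarrow> K i p = 0" "0 < K p p" 
    using Suc.prems(1) by (auto simp: lower_tri_def)
  have upd[measurable]: "(\<lambda>(x, y). x(p := y)) \<in> measurable (PiM {..<p} (\<lambda>_. borel) \<Otimes>\<^sub>M borel) (PiM {..<Suc p} (\<lambda>_. borel :: real measure))"
    unfolding lessThan_Suc by (rule measurable_add_dim)
  \<comment> \<open>The integral over the last coordinate alone; the induction hypothesis is applied
    to this function of the remaining ones.\<close>
  define h where "h x = (\<integral>\<^sup>+y. f (x(p := y)) \<partial>lborel)" for x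
  have fm: "(\<lambda>xy. f ((fst xy)(p := snd xy))) \<in> borel_measurable (PiM {..<p} (\<lambda>_. borel) \<Otimes>\<^sub>M borel)"
    using measurable_compose[OF upd f] by (simp add: case_prod_beta)
  have h[measurable]: "h \<in> borel_measurable (PiM {..<p} (\<lambda>_. borel))"
    unfolding h_def
    by (rule lborel.borel_measurable_nn_integral) (use fm in \<open>simp add: case_prod_beta cong: measurable_cong_sets\<close>)
  have fold: "(\<integral>\<^sup>+x. g x \<partial>PiM {..<Suc p} (\<lambda>_. lborel)) = (\<integral>\<^sup>+x. (\<integral>\<^sup>+y. g (x(p := y)) \<partial>lborel) \<partial>PiM {..<p} (\<lambda>_. lborel))"
    if g[measurable]: "g \<in> borel_measurable (PiM {..<Suc p} (\<lambda>_. borel))" for g :: "(nat \<Rightarrow> real) \<Rightarrow> ennreal"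
  proof -
    have "g \<in> borel_measurable (PiM (insert p {..<p}) (\<lambda>_. lborel))"
      using g by (simp add: lessThan_Suc cong: measurable_cong_sets)
    then show ?thesis
      using L.product_nn_integral_insert[of "{..<p}" p g] by (simp add: lessThan_Suc)
  qed
  have split: "mat_app (Suc p) K (\<lambda>j. (x(p := y)) j - t j) =
     (mat_app p K (\<lambda>j. x j - t j))(p := ((\<Sum>j<p. K p j * (x j - t j)) - K p p * t p) + K p p * y)" for x y
  proof (rule ext)
    fix i
    have eq: "(\<Sum>j<p. K i j * ((x(p := y)) j - t j)) = (\<Sum>j<p. K i j * (x j - t j))"
      by (intro sum.cong) auto
    consider "i < p" | "i = p" | "p < i" by linarith
    then show "mat_app (Suc p) K (\<lambda>j. (x(p := y)) j - t j) i =
       ((mat_app p K (\<lambda>j. x j - t j))(p := ((\<Sum>j<p. K p j * (x j - t j)) - K p p * t p) + K p p * y)) i"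
    proof cases
      case 1
      then show ?thesis unfolding mat_app_def sum.lessThan_Suc eq using lower_tri(2)[OF 1] by simp
    next
      case 2
      then show ?thesis unfolding mat_app_def sum.lessThan_Suc eq by (simp add: right_diff_distrib)
    next
      case 3
      then show ?thesis unfolding mat_app_def by simp
    qed
  qed
  \<comment> \<open>For fixed x this is an affine substitution on the line with slope
    \<open>K p p\<close>. Its offset depends on x and t but is absorbed by the translation
    invariance of Lebesgue measure.\<close>
  have inner: "K p p * (\<integral>\<^sup>+y. f (mat_app (Suc p) K (\<lambda>j. (x(p := y)) j - t j)) \<partial>lborel) = h (mat_app p K (\<lambda>j. x j - t j))"
    for x
  proof -
    have "(\<lambda>y. f ((mat_app p K (\<lambda>j. x j - t j))(p := y))) \<in> borel_measurable borel"
      using measurable_compose[OF measurable_Pair1' fm, of "mat_app p K (\<lambda>j. x j - t j)"]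
      by (simp add: mat_app_def space_PiM)
    then show ?thesis
      unfolding h_def split
      using lower_tri(3) by (subst (2) nn_integral_real_affine[where c="K p p" and t="(\<Sum>j<p. K p j * (x j - t j)) - K p p * t p"]) auto
  qed
  have pm: "ennreal ((\<Prod>i<p. K i i) * K p p) = ennreal (\<Prod>i<p. K i i) * ennreal (K p p)"
    using lower_tri(3) by (intro ennreal_mult'') simp
  have "ennreal (\<Prod>i<Suc p. K i i) * (\<integral>\<^sup>+x. f (mat_app (Suc p) K (\<lambda>j. x j - t j)) \<partial>PiM {..<Suc p} (\<lambda>_. lborel)) 
    = ennreal (\<Prod>i<p. K i i) * (K p p * (\<integral>\<^sup>+x. (\<integral>\<^sup>+y. f (mat_app (Suc p) K (\<lambda>j. (x(p := y)) j - t j)) \<partial>lborel) \<partial>PiM {..<p} (\<lambda>_. lborel)))"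
  proof -
    have "(\<lambda>x. f (mat_app (Suc p) K (\<lambda>j. x j - t j))) \<in> borel_measurable (PiM {..<Suc p} (\<lambda>_. borel))"
      by (rule measurable_compose[OF _ f], rule mat_app_measurable) auto
    note eq = fold[OF this]
    show ?thesis unfolding eq prod.lessThan_Suc pm mult.assoc ..
  qed
  also have "\<dots> = ennreal (\<Prod>i<p. K i i) * (\<integral>\<^sup>+x. h (mat_app p K (\<lambda>j. x j - t j)) \<partial>PiM {..<p} (\<lambda>_. lborel))"
  proof -
    have sets_eq: "sets (PiM {..<p} (\<lambda>_. lborel :: real measure) \<Otimes>\<^sub>M lborel) =
        sets (PiM {..<p} (\<lambda>_. borel :: real measure) \<Otimes>\<^sub>M borel)"
      by (intro sets_pair_measure_cong) (simp_all cong: sets_PiM_cong)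
    have "(\<lambda>xy. f (mat_app (Suc p) K (\<lambda>j. ((fst xy)(p := snd xy)) j - t j))) \<in>
        borel_measurable (PiM {..<p} (\<lambda>_. borel) \<Otimes>\<^sub>M borel)"
    proof (rule measurable_compose[OF _ f], rule mat_app_measurable)
      fix j assume "j < Suc p"
      then show "(\<lambda>xy. ((fst xy)(p := snd xy)) j - t j) \<in> borel_measurable (PiM {..<p} (\<lambda>_. borel) \<Otimes>\<^sub>M borel)"
        by (cases "j = p") auto
    qed
    then have "(\<lambda>x. \<integral>\<^sup>+y. f (mat_app (Suc p) K (\<lambda>j. (x(p := y)) j - t j)) \<partial>lborel) \<in>
        borel_measurable (PiM {..<p} (\<lambda>_. lborel))"
      unfolding measurable_cong_sets[OF sets_eq refl, symmetric]
      by (intro lborel.borel_measurable_nn_integral) (simp only: case_prod_beta')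
    note eq = nn_integral_cmult[OF this, of "ennreal (K p p)", unfolded inner]
    show ?thesis unfolding eq ..
  qed
  also have "\<dots> = (\<integral>\<^sup>+x. h x \<partial>PiM {..<p} (\<lambda>_. lborel))"
    by (rule Suc.IH[OF lower_tri(1) h])
  also have "\<dots> = (\<integral>\<^sup>+x. f x \<partial>PiM {..<Suc p} (\<lambda>_. lborel))"
    unfolding h_def by (rule fold[OF f, symmetric])
  finally show ?case .
qed

text \<open>The parameter is the standard deviation, as in \<open>normal_density\<close>; the
  variance is its square.\<close>

definition gauss :: "real \<Rightarrow> real measure" where
  "gauss s = density lborel (normal_density 0 s)"

lemma space_gauss [simp]: "space (gauss s) = UNIV"
  and sets_gauss [simp, measurable_cong]: "sets (gauss s) = sets borel"
  by (simp_all add: gauss_def)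

lemma prob_space_gauss: "0 < s \<Longrightarrow> prob_space (gauss s)"
  unfolding gauss_def by (rule prob_space_normal_density)

lemma distr_gauss_scale:
  assumes "0 < s" "0 < c"
  shows "distr (gauss s) borel (\<lambda>x. c * x) = gauss (c * s)"
proof -
  interpret prob_space "gauss s" using assms by (intro prob_space_gauss)
  have "distributed (gauss s) lborel (\<lambda>x. x) (normal_density 0 s)"
    unfolding distributed_def by (simp add: gauss_def distr_id2)
  from normal_density_affine[OF this \<open>0 < s\<close>, of c 0]
  have "distr (gauss s) lborel (\<lambda>x. c * x) = gauss (c * s)"
    using assms by (simp add: distributed_def gauss_def)
  then show ?thesis by (simp cong: distr_cong)
qed

text \<open>The exponent is the squared norm of the whitened vector because S^{-1} = K^T K, and 1 /
  sqrt (det S) is the product of the diagonal of K. The leading factor is thus the Jacobian of the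
  whitening map.\<close>

lemma gauss_density_whitened:
  assumes "lower_tri p K" "whitens p K S"
  shows "gauss_density p m S x =
    (\<Prod>i<p. K i i) * (\<Prod>i<p. std_normal_density (mat_app p K (\<lambda>j. x j - m j) i))"
proof -
  let ?k = "\<Prod>i<p. K i i" and ?y = "mat_app p K (\<lambda>j. x j - m j)"
  have k: "0 < ?k" using assms by (rule prod_diag_pos)
  have "det_p p S = 1 / ?k\<^sup>2"
    using det_whitened[OF assms] k
    by (subst nonzero_eq_divide_eq) (auto simp only: power2_eq_square mult_eq_0_iff)
  then have e: "sqrt (c ^ p * det_p p S) = sqrt c ^ p / ?k" for c
    using k by (simp add: real_sqrt_divide real_sqrt_power del: prod_zero_iff)
  have q: "bil p (mat_inv p S) (\<lambda>i. x i - m i) (\<lambda>i. x i - m i) = (\<Sum>i<p. (?y i)\<^sup>2)"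
    by (simp add: bil_mat_inv[OF assms] dot_def mat_app_def power2_eq_square)
  have d: "(\<Prod>i<p. std_normal_density (?y i)) = exp (- (\<Sum>i<p. (?y i)\<^sup>2) / 2) / sqrt (2 * pi) ^ p"
    by (simp add: std_normal_density_def prod.distrib exp_sum sum_negf[symmetric]
        sum_divide_distrib power_one_over prod_dividef)
  show ?thesis
    unfolding gauss_density_def e q d by simp
qed

text \<open>The density is the Jacobian times a standard Gaussian density composed with the
  whitening map, so the change of variables absorbs the Jacobian and leaves independent standard
  normal coordinates.\<close>

lemma distr_mvn_whitened:
  assumes K: "lower_tri p K" "whitens p K S"
  shows "distr (mvn p m S) (PiM {..<p} (\<lambda>_. borel)) (\<lambda>x. mat_app p K (\<lambda>j. x j - m j)) =
    PiM {..<p} (\<lambda>_. gauss 1)"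
proof -
  have [measurable_cong]: "sets (PiM I (\<lambda>_. lborel)) = sets (PiM I (\<lambda>_. borel :: real measure))" for I :: "nat set"
    by (simp cong: sets_PiM_cong)
  define T where "T x = mat_app p K (\<lambda>j. x j - m j)" for x
  define phi where "phi y = (\<Prod>i<p. std_normal_density (y i))" for y :: "nat \<Rightarrow> real"
  have [measurable]: "T \<in> measurable (PiM {..<p} (\<lambda>_. lborel)) (PiM {..<p} (\<lambda>_. borel))"
    unfolding T_def by (rule mat_app_measurable) simp
  have [measurable]: "phi \<in> borel_measurable (PiM {..<p} (\<lambda>_. borel))"
    unfolding phi_def by measurable
  have k: "0 \<le> (\<Prod>i<p. K i i)"
    using prod_diag_pos[OF K] by simp
  have mvn: "mvn p m S = density (PiM {..<p} (\<lambda>_. lborel)) (\<lambda>x. ennreal ((\<Prod>i<p. K i i)) * ennreal (phi (T x)))"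
    unfolding mvn_def phi_def T_def gauss_density_whitened[OF K]
    using k by (simp add: ennreal_mult')
  have "distr (mvn p m S) (PiM {..<p} (\<lambda>_. borel)) T =
    density (PiM {..<p} (\<lambda>_. lborel)) (\<lambda>y. ennreal (phi y))"
  proof (rule measure_eqI)
    fix A assume "A \<in> sets (distr (mvn p m S) (PiM {..<p} (\<lambda>_. borel)) T)"
    then have A[measurable]: "A \<in> sets (PiM {..<p} (\<lambda>_. borel))" by simp
    have "emeasure (distr (mvn p m S) (PiM {..<p} (\<lambda>_. borel)) T) A =
      (\<integral>\<^sup>+x. indicator A x \<partial>distr (mvn p m S) (PiM {..<p} (\<lambda>_. borel)) T)"
      by (subst nn_integral_indicator) auto
    also have "\<dots> = (\<integral>\<^sup>+x. indicator A (T x) \<partial>mvn p m S)"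
      by (rule nn_integral_distr) (auto simp: mvn)
    also have "\<dots> = (\<integral>\<^sup>+x. ennreal ((\<Prod>i<p. K i i)) * (ennreal (phi (T x)) * indicator A (T x)) \<partial>PiM {..<p} (\<lambda>_. lborel))"
      unfolding mvn by (subst nn_integral_density) (auto simp: mult.assoc)
    also have "\<dots> = (\<Prod>i<p. K i i) * (\<integral>\<^sup>+x. ennreal (phi (T x)) * indicator A (T x) \<partial>PiM {..<p} (\<lambda>_. lborel))"
      by (rule nn_integral_cmult) measurable
    also have "\<dots> = (\<integral>\<^sup>+y. ennreal (phi y) * indicator A y \<partial>PiM {..<p} (\<lambda>_. lborel))"
      unfolding T_def by (rule nn_integral_triangular[OF K(1)]) measurable
    also have "\<dots> = emeasure (density (PiM {..<p} (\<lambda>_. lborel)) (\<lambda>y. ennreal (phi y))) A"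
      by (rule emeasure_density[symmetric]) measurable
    finally show "emeasure (distr (mvn p m S) (PiM {..<p} (\<lambda>_. borel)) T) A =
      emeasure (density (PiM {..<p} (\<lambda>_. lborel)) (\<lambda>y. ennreal (phi y))) A" .
  qed (simp cong: sets_PiM_cong)
  also have "\<dots> = PiM {..<p} (\<lambda>_. gauss 1)"
    unfolding phi_def gauss_def
    by (rule PiM_lborel_density) (auto intro: prob_space_normal_density)
  finally show ?thesis unfolding T_def .
qed

lemma mvn_measurable_mat_app:
  "(\<lambda>x. mat_app p K (\<lambda>j. x j - m' j)) \<in> measurable (mvn p m S) (PiM {..<p} (\<lambda>_. borel))"
proof -
  have "(\<lambda>x. mat_app p K (\<lambda>j. x j - m' j)) \<in> measurable (PiM {..<p} (\<lambda>_. lborel)) (PiM {..<p} (\<lambda>_. borel))"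
    by (rule mat_app_measurable) (simp cong: measurable_cong_sets)
  then show ?thesis by (simp add: mvn_def)
qed

text \<open>\<open>mvn\<close> is given by a bare density, so its total mass has to be established;
  it equals that of its whitened image, which is a product of normal laws.\<close>

lemma prob_space_mvn:
  assumes "lower_tri p K" "whitens p K S"
  shows "prob_space (mvn p m S)"
proof -
  have "prob_space (distr (mvn p m S) (PiM {..<p} (\<lambda>_. borel)) (\<lambda>x. mat_app p K (\<lambda>j. x j - m j)))"
    unfolding distr_mvn_whitened[OF assms] by (intro prob_space_PiM prob_space_gauss) simp
  then show ?thesis
    by (rule prob_space_distrD[OF mvn_measurable_mat_app])
qed

lemma distr_PiM_gauss_scale:
  assumes "finite I" "0 < s" "0 < c"
  shows "distr (PiM I (\<lambda>_. gauss s)) (PiM I (\<lambda>_. borel)) (compose I (\<lambda>x. c * x)) = PiM I (\<lambda>_. gauss (c * s))"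
proof -
  have "distr (PiM I (\<lambda>_. gauss s)) (PiM I (\<lambda>_. gauss s)) (compose I (\<lambda>x. c * x)) = PiM I (\<lambda>_. distr (gauss s) (gauss s) (\<lambda>x. c * x))"
    using assms by (intro distr_PiM_finite_prob_space') (auto intro: prob_space_gauss)
  also have "distr (gauss s) (gauss s) (\<lambda>x. c * x) = gauss (c * s)"
    using distr_gauss_scale[OF assms(2,3)] by (subst distr_cong[OF refl sets_gauss refl]) auto
  also have "distr (PiM I (\<lambda>_. gauss s)) (PiM I (\<lambda>_. gauss s)) (compose I (\<lambda>x. c * x)) =
      distr (PiM I (\<lambda>_. gauss s)) (PiM I (\<lambda>_. borel)) (compose I (\<lambda>x. c * x))"
    by (intro distr_cong refl sets_PiM_cong) auto
  finally show ?thesis .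
qed

text \<open>The covariance S / r would be whitened by sqrt r K. Keeping K itself leaves standard
  deviation 1 / sqrt r, and lets the prior and the samples be mapped by one and the same
  matrix.\<close>

lemma distr_mvn_scaled_whitened:
  assumes K: "lower_tri p K" "whitens p K S" and r: "0 < r"
  shows "distr (mvn p m (scale_mat (1 / r) S)) (PiM {..<p} (\<lambda>_. borel)) (\<lambda>x. mat_app p K (\<lambda>j. x j - m j)) =
    PiM {..<p} (\<lambda>_. gauss (1 / sqrt r))"
proof -
  let ?P = "PiM {..<p} (\<lambda>_. borel :: real measure)" and ?M = "mvn p m (scale_mat (1 / r) S)"
  let ?K = "\<lambda>i j. sqrt r * K i j"
  have c: "compose {..<p} (\<lambda>x. 1 / sqrt r * x) \<in> measurable ?P ?P"
    unfolding compose_def by measurable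
  have "(\<lambda>x. mat_app p K (\<lambda>j. x j - m j)) = compose {..<p} (\<lambda>x. 1 / sqrt r * x) \<circ> (\<lambda>x. mat_app p ?K (\<lambda>j. x j - m j))"
    using r by (auto simp: mat_app_def compose_def fun_eq_iff sum_divide_distrib)
  then have "distr ?M ?P (\<lambda>x. mat_app p K (\<lambda>j. x j - m j)) = 
      distr (distr ?M ?P (\<lambda>x. mat_app p ?K (\<lambda>j. x j - m j))) ?P (compose {..<p} (\<lambda>x. 1 / sqrt r * x))"
    by (simp only: distr_distr[OF c mvn_measurable_mat_app])
  also have "\<dots> = PiM {..<p} (\<lambda>_. gauss (1 / sqrt r * 1))"
    unfolding distr_mvn_whitened[OF whitens_scale_mat[OF K r]]
    using r by (intro distr_PiM_gauss_scale) auto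
  finally show ?thesis by simp
qed

section \<open>Whitened sample means\<close>

lemma indep_vars_coordinates:
  assumes M: "\<And>i. i \<in> I \<Longrightarrow> prob_space (M i)" and "I \<noteq> {}"
  shows "prob_space.indep_vars (PiM I M) M (\<lambda>i w. w i) I"
proof -
  interpret prob_space "PiM I M" using M by (rule prob_space_PiM)
  have "distr (PiM I M) (PiM I M) (\<lambda>w. \<lambda>i\<in>I. w i) = distr (PiM I M) (PiM I M) (\<lambda>w. w)"
    by (intro distr_cong refl) (auto simp: space_PiM PiE_iff extensional_restrict)
  also have "\<dots> = PiM I (\<lambda>i. distr (PiM I M) (M i) (\<lambda>w. w i))"
    using M by (simp add: distr_id2 distr_PiM_component cong: PiM_cong)
  finally show ?thesis
    by (subst indep_vars_iff_distr_eq_PiM'[OF \<open>I \<noteq> {}\<close>]) auto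
qed

text \<open>A sample of vectors is an iterated product, while averaging regroups its entries by
  coordinate. Viewing the entries as one independent family indexed by pairs allows both
  groupings.\<close>

lemma distr_PiM_curry:
  assumes N: "prob_space N" and ne: "K \<noteq> {}" "I \<noteq> {}"
  shows "distr (PiM (K \<times> I) (\<lambda>_. N)) (PiM K (\<lambda>_. PiM I (\<lambda>_. N))) (\<lambda>w. \<lambda>k\<in>K. \<lambda>i\<in>I. w (k, i)) =
    PiM K (\<lambda>_. PiM I (\<lambda>_. N))"
proof -
  let ?W = "PiM (K \<times> I) (\<lambda>_. N)"
  interpret prob_space ?W using N by (rule prob_space_PiM)
  have "indep_vars (\<lambda>_. N) (\<lambda>j w. w j) (K \<times> I)"
    using N ne by (intro indep_vars_coordinates) auto
  then have "indep_vars (\<lambda>k. PiM ({k} \<times> I) (\<lambda>_. N)) (\<lambda>k w. restrict (\<lambda>j. w j) ({k} \<times> I)) K"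
    by (rule indep_vars_restrict) (auto simp: disjoint_family_on_def)
  then have "indep_vars (\<lambda>k. PiM I (\<lambda>_. N)) (\<lambda>k w. \<lambda>i\<in>I. restrict (\<lambda>j. w j) ({k} \<times> I) (k, i)) K"
    by (rule indep_vars_compose2) (intro measurable_restrict measurable_component_singleton, auto)
  also have "(\<lambda>k w. \<lambda>i\<in>I. restrict (\<lambda>j. w j) ({k} \<times> I) (k, i)) = (\<lambda>k w. \<lambda>i\<in>I. w (k, i))"
    by (auto simp: fun_eq_iff)
  finally have "distr ?W (PiM K (\<lambda>_. PiM I (\<lambda>_. N))) (\<lambda>w. \<lambda>k\<in>K. \<lambda>i\<in>I. w (k, i)) =
      PiM K (\<lambda>k. distr ?W (PiM I (\<lambda>_. N)) (\<lambda>w. \<lambda>i\<in>I. w (k, i)))"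
    by (subst (asm) indep_vars_iff_distr_eq_PiM'[OF ne(1)])
      (auto intro!: measurable_restrict)
  also have "\<dots> = PiM K (\<lambda>_. PiM I (\<lambda>_. N))"
  proof (intro PiM_cong refl)
    fix k assume "k \<in> K"
    then show "distr ?W (PiM I (\<lambda>_. N)) (\<lambda>w. \<lambda>i\<in>I. w (k, i)) = PiM I (\<lambda>_. N)"
      using distr_PiM_reindex[of "K \<times> I" "\<lambda>_. N" "Pair k" I] N by (auto simp: inj_on_def)
  qed
  finally show ?thesis .
qed

text \<open>On the flattened array, each column sum adds n independent standard normals and has
  standard deviation sqrt n; division by n gives 1 / sqrt n. Different columns use disjoint sets of
  entries, hence the averages are independent.\<close>

lemma distr_mean_gauss:
  fixes n p :: nat
  assumes "0 < n" "0 < p"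
  shows "distr (PiM {..<n} (\<lambda>_. PiM {..<p} (\<lambda>_. gauss 1))) (PiM {..<p} (\<lambda>_. borel))
      (\<lambda>Y. \<lambda>i\<in>{..<p}. (\<Sum>k<n. Y k i) / real n) = PiM {..<p} (\<lambda>_. gauss (1 / sqrt n))"
    (is "distr ?V ?P ?avg = _")
proof -
  let ?W = "PiM ({..<n} \<times> {..<p}) (\<lambda>_. gauss 1)"
  let ?C = "\<lambda>w. \<lambda>k\<in>{..<n}. \<lambda>i\<in>{..<p}. w (k, i) :: real"
  have ne: "{..<n} \<noteq> {}" "{..<p} \<noteq> {}" using assms by auto
  have g: "prob_space (gauss 1)" by (rule prob_space_gauss) simp
  interpret prob_space ?W using g by (rule prob_space_PiM)
  have ind: "indep_vars (\<lambda>_. gauss 1) (\<lambda>j w. w j) ({..<n} \<times> {..<p})"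
    using g ne by (intro indep_vars_coordinates) auto
  have ind': "indep_vars (\<lambda>_. borel) (\<lambda>j w. w j) ({..<n} \<times> {..<p})"
    by (rule indep_vars_compose2[OF ind]) simp
  have C: "?C \<in> measurable ?W ?V"
    by (intro measurable_restrict measurable_component_singleton) auto
  have avg: "?avg \<in> measurable ?V ?P"
  proof (intro measurable_restrict borel_measurable_divide borel_measurable_sum)
    fix i k assume "i \<in> {..<p}" "k \<in> {..<n}"
    then show "(\<lambda>Y. Y k i) \<in> borel_measurable ?V"
      by (intro measurable_compose[OF measurable_component_singleton[of k]]) auto
  qed simp
  have X: "distr ?W borel (\<lambda>w. (\<Sum>k<n. w (k, i)) / real n) = gauss (1 / sqrt n)" if "i < p" for i :: nat
  proof -
    have "distributed ?W lborel (\<lambda>w. \<Sum>j\<in>{..<n} \<times> {i}. w j)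
       (normal_density (\<Sum>j\<in>{..<n} \<times> {i}. 0) (sqrt (\<Sum>j\<in>{..<n} \<times> {i}. 1\<^sup>2)))"
    proof (rule sum_indep_normal)
      show "indep_vars (\<lambda>_. borel) (\<lambda>j w. w j) ({..<n} \<times> {i})"
        using that by (intro indep_vars_subset[OF ind']) auto
      fix j assume "j \<in> {..<n} \<times> {i}"
      then have "distr ?W (gauss 1) (\<lambda>w. w j) = gauss 1"
        using that g by (intro distr_PiM_component) auto
      moreover have "distr ?W lborel (\<lambda>w. w j) = distr ?W (gauss 1) (\<lambda>w. w j)"
        by (intro distr_cong) auto
      ultimately show "distributed ?W lborel (\<lambda>w. w j) (normal_density 0 1)"
        using that \<open>j \<in> _\<close> by (auto simp: distributed_def gauss_def)
    qed (use \<open>0 < n\<close> in auto)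
    moreover have "(\<Sum>j\<in>{..<n} \<times> {i}. w j) = (\<Sum>k<n. w (k, i))" for w :: "nat \<times> nat \<Rightarrow> real"
      by (rule sum.reindex_bij_witness[of _ "\<lambda>k. (k, i)" fst]) auto
    ultimately have "distributed ?W lborel (\<lambda>w. \<Sum>k<n. w (k, i)) (normal_density 0 (sqrt n))"
      by (simp add: card_cartesian_product)
    from normal_density_affine[OF this, of "1 / real n" 0] \<open>0 < n\<close>
    have "distr ?W lborel (\<lambda>w. (\<Sum>k<n. w (k, i)) / real n) = gauss (sqrt n / n)"
      by (simp add: distributed_def gauss_def)
    also have "distr ?W lborel (\<lambda>w. (\<Sum>k<n. w (k, i)) / real n) = distr ?W borel (\<lambda>w. (\<Sum>k<n. w (k, i)) / real n)"
      by (intro distr_cong) auto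
    also have "sqrt n / n = 1 / sqrt n"
      using \<open>0 < n\<close> by (simp add: field_simps)
    finally show ?thesis .
  qed
  have "distr ?V ?P ?avg = distr (distr ?W ?V ?C) ?P ?avg"
    by (subst distr_PiM_curry[OF g ne]) simp
  also have "\<dots> = distr ?W ?P (?avg \<circ> ?C)"
    by (rule distr_distr[OF avg C])
  also have "?avg \<circ> ?C = (\<lambda>w. \<lambda>i\<in>{..<p}. (\<Sum>k<n. w (k, i)) / real n)"
    by (auto simp: fun_eq_iff)
  also have "distr ?W ?P \<dots> = PiM {..<p} (\<lambda>i. distr ?W borel (\<lambda>w. (\<Sum>k<n. w (k, i)) / real n))"
  proof -
    have "indep_vars (\<lambda>i. PiM ({..<n} \<times> {i}) (\<lambda>_. borel)) (\<lambda>i w. restrict (\<lambda>j. w j) ({..<n} \<times> {i})) {..<p}"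
      by (rule indep_vars_restrict[OF ind']) (auto simp: disjoint_family_on_def)
    then have "indep_vars (\<lambda>_. borel) (\<lambda>i w. (\<Sum>k<n. restrict (\<lambda>j. w j) ({..<n} \<times> {i}) (k, i)) / real n) {..<p}"
      by (rule indep_vars_compose2)
        (intro borel_measurable_divide borel_measurable_sum measurable_component_singleton, auto)
    then have "indep_vars (\<lambda>_. borel) (\<lambda>i w. (\<Sum>k<n. w (k, i)) / real n) {..<p}"
      by simp
    then show ?thesis
      by (subst (asm) indep_vars_iff_distr_eq_PiM'[OF ne(2)]) auto
  qed
  also have "\<dots> = PiM {..<p} (\<lambda>_. gauss (1 / sqrt n))"
    using X by (intro PiM_cong) auto
  finally show ?thesis .
qed

text \<open>Averaging commutes with the affine map x to K (x - m), so the whitened sample mean is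
  the average of whitened sample points, which are standard Gaussian. The resulting law does not
  depend on m, and this is what decouples the samples from the random class means.\<close>

lemma
  assumes K: "lower_tri p K" "whitens p K S" and "0 < n" "0 < p"
  shows distr_sample_mean_whitened: "distr (PiM {..<n} (\<lambda>_. mvn p m S)) (PiM {..<p} (\<lambda>_. borel))
      (\<lambda>X. mat_app p K (\<lambda>j. sample_mean n X j - m j)) = PiM {..<p} (\<lambda>_. gauss (1 / sqrt n))"
    and sample_mean_measurable_mat_app: 
     "(\<lambda>X. mat_app p K (\<lambda>j. sample_mean n X j - m j)) \<in> measurable (PiM {..<n} (\<lambda>_. mvn p m S)) (PiM {..<p} (\<lambda>_. borel))"
proof -
  let ?M = "PiM {..<n} (\<lambda>_. mvn p m S)" and ?P = "PiM {..<p} (\<lambda>_. borel)"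
  let ?V = "PiM {..<n} (\<lambda>_. PiM {..<p} (\<lambda>_. gauss 1))"
  let ?T = "\<lambda>x. mat_app p K (\<lambda>j. x j - m j)"
  let ?avg = "\<lambda>Y. \<lambda>i\<in>{..<p}. (\<Sum>k<n. Y k i) / real n"
  have [measurable_cong]: "sets (PiM {..<p} (\<lambda>_. gauss 1)) = sets ?P"
    by (intro sets_PiM_cong) auto
  have T: "?T \<in> measurable (mvn p m S) (PiM {..<p} (\<lambda>_. gauss 1))"
    using mvn_measurable_mat_app by measurable
  have c: "compose {..<n} ?T \<in> measurable ?M ?V"
    unfolding compose_def
    by (intro measurable_restrict measurable_compose[OF _ T] measurable_component_singleton)
  have avg: "?avg \<in> measurable ?V ?P"
  proof (intro measurable_restrict borel_measurable_divide borel_measurable_sum)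
    fix i k assume "i \<in> {..<p}" "k \<in> {..<n}"
    then show "(\<lambda>Y. Y k i) \<in> borel_measurable ?V"
      by (intro measurable_compose[OF measurable_component_singleton[of k]]) auto
  qed simp
  have split: "(\<lambda>X. mat_app p K (\<lambda>j. sample_mean n X j - m j)) = ?avg \<circ> compose {..<n} ?T"
  proof (intro ext)
    fix X i
    show "mat_app p K (\<lambda>j. sample_mean n X j - m j) i = (?avg \<circ> compose {..<n} ?T) X i"
    proof (cases "i < p")
      case True
      have "(\<Sum>k<n. \<Sum>j<p. K i j * (X k j - m j)) / n = (\<Sum>j<p. \<Sum>k<n. K i j * (X k j - m j)) / n"
        by (subst sum.swap) simp
      also have "\<dots> = (\<Sum>j<p. K i j * (sample_mean n X j - m j))"
      proof -
        have "c * (a - real n * b) / real n = c * (a / real n - b)" for a b c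
          using \<open>0 < n\<close> by (simp add: field_simps)
        then show ?thesis
          unfolding sum_divide_distrib
          by (intro sum.cong refl)
            (simp add: sample_mean_def sum_distrib_left[symmetric] sum_divide_distrib[symmetric] sum_subtractf)
      qed
      finally show ?thesis using True by (simp add: mat_app_def compose_def)
    qed (simp add: mat_app_def)
  qed
  show "(\<lambda>X. mat_app p K (\<lambda>j. sample_mean n X j - m j)) \<in> measurable ?M ?P"
    unfolding split using c avg by (rule measurable_comp)
  have "distr ?M ?P (\<lambda>X. mat_app p K (\<lambda>j. sample_mean n X j - m j)) = distr (distr ?M ?V (compose {..<n} ?T)) ?P ?avg"
    unfolding split by (rule distr_distr[OF avg c, symmetric])
  also have "distr ?M ?V (compose {..<n} ?T) = PiM {..<n} (\<lambda>_. distr (mvn p m S) (PiM {..<p} (\<lambda>_. gauss 1)) ?T)"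
    using T prob_space_mvn[OF K] by (intro distr_PiM_finite_prob_space' prob_space_PiM prob_space_gauss) auto
  also have "distr (mvn p m S) (PiM {..<p} (\<lambda>_. gauss 1)) ?T = distr (mvn p m S) ?P ?T"
    by (intro distr_cong refl sets_PiM_cong) auto
  also have "\<dots> = PiM {..<p} (\<lambda>_. gauss 1)"
    by (rule distr_mvn_whitened[OF K])
  also have "distr ?V ?P ?avg = PiM {..<p} (\<lambda>_. gauss (1 / sqrt n))"
    by (rule distr_mean_gauss) fact+
  finally show "distr ?M ?P (\<lambda>X. mat_app p K (\<lambda>j. sample_mean n X j - m j)) = PiM {..<p} (\<lambda>_. gauss (1 / sqrt n))" .
qed

section \<open>The joint law of the whitened increments\<close>

definition gauss_vec :: "nat \<Rightarrow> real \<Rightarrow> (nat \<Rightarrow> real) measure" where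
  "gauss_vec p s = PiM {..<p} (\<lambda>_. gauss s)"

lemma sets_gauss_vec [measurable_cong]: "sets (gauss_vec p s) = sets (PiM {..<p} (\<lambda>_. borel))"
  unfolding gauss_vec_def by (intro sets_PiM_cong) auto

lemma space_gauss_vec: "space (gauss_vec p s) = space (PiM {..<p} (\<lambda>_. borel))"
  by (simp add: gauss_vec_def space_PiM)

lemma prob_space_gauss_vec: "0 < s \<Longrightarrow> prob_space (gauss_vec p s)"
  unfolding gauss_vec_def by (intro prob_space_PiM prob_space_gauss)

lemma prob_space_pair:
  assumes "prob_space M" "prob_space N"
  shows "prob_space (M \<Otimes>\<^sub>M N)"
proof -
  interpret M: prob_space M by fact
  interpret N: prob_space N by fact
  interpret pair_prob_space M N ..
  show ?thesis by unfold_locales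
qed

lemma integral_pair_bounded:
  fixes f :: "'a \<times> 'b \<Rightarrow> real"
  assumes M: "prob_space M" and N: "prob_space N"
    and f: "f \<in> borel_measurable (M \<Otimes>\<^sub>M N)" and B: "\<And>z. \<bar>f z\<bar> \<le> B"
  shows "(\<integral>z. f z \<partial>(M \<Otimes>\<^sub>M N)) = (\<integral>x. (\<integral>y. f (x, y) \<partial>N) \<partial>M)"
proof -
  interpret M: prob_space M by fact
  interpret N: prob_space N by fact
  interpret pair_prob_space M N ..
  have "integrable (M \<Otimes>\<^sub>M N) f"
    using f B by (intro P.integrable_const_bound[of _ B]) auto
  then show ?thesis by (rule integral_fst'[symmetric])
qed

definition whitened :: "nat \<Rightarrow> (nat \<Rightarrow> nat) \<Rightarrow> (nat \<Rightarrow> real) \<Rightarrow>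
    ((nat \<Rightarrow> real) \<times> (nat \<Rightarrow> real) \<times> (nat \<Rightarrow> real) \<times> (nat \<Rightarrow> real)) measure" where
  "whitened p n nu = gauss_vec p (1 / sqrt (nu 0)) \<Otimes>\<^sub>M (gauss_vec p (1 / sqrt (nu 1)) \<Otimes>\<^sub>M
     (gauss_vec p (1 / sqrt (real (n 0))) \<Otimes>\<^sub>M gauss_vec p (1 / sqrt (real (n 1)))))"

text \<open>Once the integrand depends only on whitened increments, each inner law is free of the
  outer variables, and the nested integral can be read as an integral over a product measure. The
  bound on G supplies integrability for Fubini.\<close>

lemma joint_exp_whitened:
  assumes K: "lower_tri p K" "whitens p K S" and p: "0 < p"
    and nu: "0 < nu 0" "0 < nu 1" and n: "0 < n 0" "0 < n 1"
    and G: "G \<in> borel_measurable (whitened p n nu)" and B: "\<And>z. \<bar>G z\<bar> \<le> B"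
    and g: "\<And>mu0 mu1 x0 x1. g mu0 mu1 x0 x1 =
      G (mat_app p K (\<lambda>j. mu0 j - m 0 j), mat_app p K (\<lambda>j. mu1 j - m 1 j),
         mat_app p K (\<lambda>j. x0 j - mu0 j), mat_app p K (\<lambda>j. x1 j - mu1 j))"
  shows "joint_exp p S n nu m g = (\<integral>z. G z \<partial>whitened p n nu)"
proof -
  let ?P = "PiM {..<p} (\<lambda>_. borel :: real measure)"
  define A0 A1 B0 B1 where "A0 = gauss_vec p (1 / sqrt (nu 0))" and "A1 = gauss_vec p (1 / sqrt (nu 1))"
    and "B0 = gauss_vec p (1 / sqrt (real (n 0)))" and "B1 = gauss_vec p (1 / sqrt (real (n 1)))"
  note defs = A0_def A1_def B0_def B1_def
  have W: "whitened p n nu = A0 \<Otimes>\<^sub>M (A1 \<Otimes>\<^sub>M (B0 \<Otimes>\<^sub>M B1))"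
    by (simp add: whitened_def defs)
  have ps: "prob_space A0" "prob_space A1" "prob_space B0" "prob_space B1"
    using nu n by (auto intro!: prob_space_gauss_vec simp: defs)
  interpret A0: prob_space A0 by fact
  interpret A1: prob_space A1 by fact
  interpret B0: prob_space B0 by fact
  interpret B1: prob_space B1 by fact
  have [measurable_cong]: "sets A0 = sets ?P" "sets A1 = sets ?P" "sets B0 = sets ?P" "sets B1 = sets ?P"
    by (simp_all add: defs sets_gauss_vec)
  have [measurable]: "G \<in> borel_measurable (?P \<Otimes>\<^sub>M (?P \<Otimes>\<^sub>M (?P \<Otimes>\<^sub>M ?P)))"
    using G unfolding W by measurable
  have mat_app_space: "mat_app p K x \<in> space ?P" for x by (simp add: mat_app_def space_PiM)
  let ?L = "\<lambda>x y. mat_app p K (\<lambda>j. x j - y j)"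
  \<comment> \<open>In each of the four identities the right-hand side is free of the mean of the
    measure on the left. The innermost integral can therefore be replaced for all values of the
    outer variables, and the nest is rewritten from the inside out.\<close>
  have 1: "(\<integral>X1. h (?L (sample_mean (n 1) X1) mu1) \<partial>PiM {..<n 1} (\<lambda>_. mvn p mu1 S)) = (\<integral>b1. h b1 \<partial>B1)"
    if "h \<in> borel_measurable ?P" for h :: "_ \<Rightarrow> real" and mu1
    unfolding B1_def gauss_vec_def distr_sample_mean_whitened[OF K n(2) p, of mu1, symmetric]
    by (rule integral_distr[OF sample_mean_measurable_mat_app[OF K n(2) p] that, symmetric])
  have 2: "(\<integral>X0. h (?L (sample_mean (n 0) X0) mu0) \<partial>PiM {..<n 0} (\<lambda>_. mvn p mu0 S)) = (\<integral>b0. h b0 \<partial>B0)"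
    if "h \<in> borel_measurable ?P" for h :: "_ \<Rightarrow> real" and mu0
    unfolding B0_def gauss_vec_def distr_sample_mean_whitened[OF K n(1) p, of mu0, symmetric]
    by (rule integral_distr[OF sample_mean_measurable_mat_app[OF K n(1) p] that, symmetric])
  have 3: "(\<integral>mu1. h (?L mu1 (m 1)) \<partial>mvn p (m 1) (scale_mat (1 / nu 1) S)) = (\<integral>a1. h a1 \<partial>A1)"
    if "h \<in> borel_measurable ?P" for h :: "_ \<Rightarrow> real"
    unfolding A1_def gauss_vec_def distr_mvn_scaled_whitened[OF K nu(2), of "m 1", symmetric]
    by (rule integral_distr[OF mvn_measurable_mat_app that, symmetric])
  have 4: "(\<integral>mu0. h (?L mu0 (m 0)) \<partial>mvn p (m 0) (scale_mat (1 / nu 0) S)) = (\<integral>a0. h a0 \<partial>A0)"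
    if "h \<in> borel_measurable ?P" for h :: "_ \<Rightarrow> real"
    unfolding A0_def gauss_vec_def distr_mvn_scaled_whitened[OF K nu(1), of "m 0", symmetric]
    by (rule integral_distr[OF mvn_measurable_mat_app that, symmetric])
  have m1: "(\<lambda>b1. G (a0, a1, b0, b1)) \<in> borel_measurable ?P"
    if [measurable]: "a0 \<in> space ?P" "a1 \<in> space ?P" "b0 \<in> space ?P" for a0 a1 b0
    by measurable
  have m2: "(\<lambda>b0. \<integral>b1. G (a0, a1, b0, b1) \<partial>B1) \<in> borel_measurable ?P"
    if [measurable]: "a0 \<in> space ?P" "a1 \<in> space ?P" for a0 a1
    by measurable
  have m3: "(\<lambda>a1. \<integral>b0. (\<integral>b1. G (a0, a1, b0, b1) \<partial>B1) \<partial>B0) \<in> borel_measurable ?P"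
    if [measurable]: "a0 \<in> space ?P" for a0
    by measurable
  have m4: "(\<lambda>a0. \<integral>a1. (\<integral>b0. (\<integral>b1. G (a0, a1, b0, b1) \<partial>B1) \<partial>B0) \<partial>A1) \<in> borel_measurable ?P"
    by measurable
  have "joint_exp p S n nu m g = (\<integral>a0. (\<integral>a1. (\<integral>b0. (\<integral>b1. G (a0, a1, b0, b1) \<partial>B1) \<partial>B0) \<partial>A1) \<partial>A0)"
    unfolding joint_exp_def g
    by (subst 1[OF m1], (rule mat_app_space)+, subst 2[OF m2], (rule mat_app_space)+, subst 3[OF m3], rule mat_app_space, subst 4[OF m4], rule refl)
  also have "\<dots> = (\<integral>z. G z \<partial>whitened p n nu)"
  proof -
    note prob_space_pair[OF ps(3,4)]
    note pp = prob_space_pair[OF ps(2) this] this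
    have "(\<integral>z. G z \<partial>whitened p n nu) = (\<integral>a0. (\<integral>z. G (a0, z) \<partial>(A1 \<Otimes>\<^sub>M (B0 \<Otimes>\<^sub>M B1))) \<partial>A0)"
      unfolding W using G B ps pp by (intro integral_pair_bounded) (auto simp: W)
    also have "\<dots> = (\<integral>a0. (\<integral>a1. (\<integral>z. G (a0, a1, z) \<partial>(B0 \<Otimes>\<^sub>M B1)) \<partial>A1) \<partial>A0)"
    proof (rule Bochner_Integration.integral_cong[OF refl])
      fix a0 assume "a0 \<in> space A0"
      then have [measurable]: "a0 \<in> space ?P" by (simp add: defs space_gauss_vec)
      show "(\<integral>z. G (a0, z) \<partial>(A1 \<Otimes>\<^sub>M (B0 \<Otimes>\<^sub>M B1))) = (\<integral>a1. (\<integral>z. G (a0, a1, z) \<partial>(B0 \<Otimes>\<^sub>M B1)) \<partial>A1)"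
        using B ps pp by (intro integral_pair_bounded[where B=B]) auto
    qed
    also have "\<dots> = (\<integral>a0. (\<integral>a1. (\<integral>b0. (\<integral>b1. G (a0, a1, b0, b1) \<partial>B1) \<partial>B0) \<partial>A1) \<partial>A0)"
    proof (intro Bochner_Integration.integral_cong[OF refl])
      fix a0 a1 assume "a0 \<in> space A0" "a1 \<in> space A1"
      then have [measurable]: "a0 \<in> space ?P" "a1 \<in> space ?P" by (simp_all add: defs space_gauss_vec)
      show "(\<integral>z. G (a0, a1, z) \<partial>(B0 \<Otimes>\<^sub>M B1)) = (\<integral>b0. (\<integral>b1. G (a0, a1, b0, b1) \<partial>B1) \<partial>B0)"
        using B ps pp by (intro integral_pair_bounded[where B=B]) auto
    qed
    finally show ?thesis ..
  qed
  finally show ?thesis .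
qed

section \<open>Convergence in probability\<close>

text \<open>A filter on pairs of an index p and a sample point of the p-th space: a property holds eventually
  if it fails, for large p, only inside events of vanishing measure. Convergence in probability is
  then convergence along this filter, so that the calculus of limits applies to it.\<close>
definition in_prob :: "(nat \<Rightarrow> 'a measure) \<Rightarrow> (nat \<times> 'a) filter" where
  "in_prob M = Abs_filter (\<lambda>P. \<exists>A. (\<forall>p. A p \<in> sets (M p)) \<and> (\<lambda>p. measure (M p) (A p)) \<longlonglongrightarrow> 0 \<and>
     (\<forall>\<^sub>F p in sequentially. \<forall>\<omega> \<in> space (M p) - A p. P (p, \<omega>)))"

text \<open>The events A p are measurable covers of the set where P fails, which may itself be
  nonmeasurable. A conjunction is covered by the union of two such events, and subadditivity keeps
  its measure vanishing; this is the filter property that needs an argument.\<close>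

lemma eventually_in_prob:
  "eventually P (in_prob M) \<longleftrightarrow>
    (\<exists>A. (\<forall>p. A p \<in> sets (M p)) \<and> (\<lambda>p. measure (M p) (A p)) \<longlonglongrightarrow> 0 \<and>
      (\<forall>\<^sub>F p in sequentially. \<forall>\<omega> \<in> space (M p) - A p. P (p, \<omega>)))"
  unfolding in_prob_def
proof (rule eventually_Abs_filter, rule is_filter.intro)
  show "\<exists>A. (\<forall>p. A p \<in> sets (M p)) \<and> (\<lambda>p. measure (M p) (A p)) \<longlonglongrightarrow> 0 \<and>
      (\<forall>\<^sub>F p in sequentially. \<forall>\<omega> \<in> space (M p) - A p. True)"
    by (intro exI[of _ "\<lambda>_. {}"]) auto
next
  fix P Q :: "nat \<times> 'a \<Rightarrow> bool"
  assume "\<exists>A. (\<forall>p. A p \<in> sets (M p)) \<and> (\<lambda>p. measure (M p) (A p)) \<longlonglongrightarrow> 0 \<and>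
      (\<forall>\<^sub>F p in sequentially. \<forall>\<omega> \<in> space (M p) - A p. P (p, \<omega>))"
  then obtain A where A: "\<And>p. A p \<in> sets (M p)" "(\<lambda>p. measure (M p) (A p)) \<longlonglongrightarrow> 0"
      "\<forall>\<^sub>F p in sequentially. \<forall>\<omega> \<in> space (M p) - A p. P (p, \<omega>)" by blast
  assume "\<exists>A. (\<forall>p. A p \<in> sets (M p)) \<and> (\<lambda>p. measure (M p) (A p)) \<longlonglongrightarrow> 0 \<and>
      (\<forall>\<^sub>F p in sequentially. \<forall>\<omega> \<in> space (M p) - A p. Q (p, \<omega>))"
  then obtain B where B: "\<And>p. B p \<in> sets (M p)" "(\<lambda>p. measure (M p) (B p)) \<longlonglongrightarrow> 0"
      "\<forall>\<^sub>F p in sequentially. \<forall>\<omega> \<in> space (M p) - B p. Q (p, \<omega>)" by blast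
  have "(\<lambda>p. measure (M p) (A p \<union> B p)) \<longlonglongrightarrow> 0"
    by (rule tendsto_sandwich[OF _ _ tendsto_const tendsto_add_zero[OF A(2) B(2)]])
       (simp_all add: measure_Un_le A(1) B(1))
  moreover have "\<forall>\<^sub>F p in sequentially. \<forall>\<omega> \<in> space (M p) - (A p \<union> B p). P (p, \<omega>) \<and> Q (p, \<omega>)"
    using A(3) B(3) by eventually_elim auto
  ultimately show "\<exists>A. (\<forall>p. A p \<in> sets (M p)) \<and> (\<lambda>p. measure (M p) (A p)) \<longlonglongrightarrow> 0 \<and>
      (\<forall>\<^sub>F p in sequentially. \<forall>\<omega> \<in> space (M p) - A p. P (p, \<omega>) \<and> Q (p, \<omega>))"
    using A(1) B(1) by (intro exI[of _ "\<lambda>p. A p \<union> B p"]) auto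
next
  fix P Q :: "nat \<times> 'a \<Rightarrow> bool"
  assume PQ: "\<forall>x. P x \<longrightarrow> Q x"
  assume "\<exists>A. (\<forall>p. A p \<in> sets (M p)) \<and> (\<lambda>p. measure (M p) (A p)) \<longlonglongrightarrow> 0 \<and>
      (\<forall>\<^sub>F p in sequentially. \<forall>\<omega> \<in> space (M p) - A p. P (p, \<omega>))"
  then obtain A where A: "\<forall>p. A p \<in> sets (M p)" "(\<lambda>p. measure (M p) (A p)) \<longlonglongrightarrow> 0"
      "\<forall>\<^sub>F p in sequentially. \<forall>\<omega> \<in> space (M p) - A p. P (p, \<omega>)" by blast
  have "\<forall>\<^sub>F p in sequentially. \<forall>\<omega> \<in> space (M p) - A p. Q (p, \<omega>)"
    using A(3) by eventually_elim (use PQ in blast)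
  with A(1,2) show "\<exists>A. (\<forall>p. A p \<in> sets (M p)) \<and> (\<lambda>p. measure (M p) (A p)) \<longlonglongrightarrow> 0 \<and>
      (\<forall>\<^sub>F p in sequentially. \<forall>\<omega> \<in> space (M p) - A p. Q (p, \<omega>))"
    by blast
qed

lemma filterlim_fst_in_prob: "filterlim fst sequentially (in_prob M)"
  unfolding filterlim_iff
proof (intro allI impI)
  fix P :: "nat \<Rightarrow> bool" assume "eventually P sequentially"
  then have "\<forall>\<^sub>F p in sequentially. \<forall>\<omega> \<in> space (M p) - {}. P (fst (p, \<omega>))"
    by eventually_elim simp
  then show "\<forall>\<^sub>F z in in_prob M. P (fst z)"
    unfolding eventually_in_prob by (intro exI[of _ "\<lambda>_. {}"] conjI) simp_all
qed

lemma tendsto_in_prob_fst: "c \<longlonglongrightarrow> l \<Longrightarrow> ((\<lambda>z. c (fst z)) \<longlongrightarrow> l) (in_prob M)"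
  by (rule filterlim_compose[OF _ filterlim_fst_in_prob])

text \<open>Chebyshev's inequality around a centre c p that may move with p; the filter calculus
  then adds the limit of the centres. The mean square is a nonnegative integral, so that the moment
  formulas can be used without separate integrability claims.\<close>

lemma tendsto_in_prob_L2:
  fixes X :: "nat \<times> 'a \<Rightarrow> real"
  assumes X: "\<forall>\<^sub>F p in sequentially. (\<lambda>\<omega>. X (p, \<omega>)) \<in> borel_measurable (M p) \<and>
      (\<integral>\<^sup>+\<omega>. ennreal ((X (p, \<omega>) - c p)\<^sup>2) \<partial>M p) \<le> ennreal (v p)"
    and v: "v \<longlonglongrightarrow> 0" and c: "c \<longlonglongrightarrow> l"
  shows "(X \<longlongrightarrow> l) (in_prob M)"
proof -
  have "((\<lambda>z. X z - c (fst z)) \<longlongrightarrow> 0) (in_prob M)"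
  proof (rule tendstoI)
    fix e :: real assume e: "0 < e"
    \<comment> \<open>Measurability of X holds only for large p, whereas the filter asks for a
      measurable event at every p; the empty set fills the remaining indices.\<close>
    define A where "A p = (if (\<lambda>\<omega>. X (p, \<omega>)) \<in> borel_measurable (M p)
      then {\<omega> \<in> space (M p). e \<le> \<bar>X (p, \<omega>) - c p\<bar>} else {})" for p
    have A: "A p \<in> sets (M p)" for p
      unfolding A_def by auto
    \<comment> \<open>The sign of v is not prescribed and \<open>ennreal\<close> truncates negative
      numbers to 0, so the real bound is expressed through \<open>max 0 (v p)\<close>.\<close>
    have bound: "\<forall>\<^sub>F p in sequentially. measure (M p) (A p) \<le> max 0 (v p) / e\<^sup>2"
      using X
    proof eventually_elim
      case (elim p)
      then have [measurable]: "(\<lambda>\<omega>. X (p, \<omega>)) \<in> borel_measurable (M p)" by simp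
      have "emeasure (M p) (A p) = (\<integral>\<^sup>+\<omega>. indicator (A p) \<omega> \<partial>M p)"
        using A by simp
      also have "\<dots> \<le> (\<integral>\<^sup>+\<omega>. ennreal (1 / e\<^sup>2) * ennreal ((X (p, \<omega>) - c p)\<^sup>2) \<partial>M p)"
      proof (rule nn_integral_mono)
        fix \<omega> 
        have "1 \<le> 1 / e\<^sup>2 * (X (p, \<omega>) - c p)\<^sup>2" if "\<omega> \<in> A p"
          using that e abs_le_square_iff[of e "X (p, \<omega>) - c p"] by (auto simp: A_def split: if_splits)
        then show "indicator (A p) \<omega> \<le> ennreal (1 / e\<^sup>2) * ennreal ((X (p, \<omega>) - c p)\<^sup>2)"
          by (auto simp: indicator_def ennreal_mult''[symmetric] ennreal_ge_1)
      qed
      also have "\<dots> = ennreal (1 / e\<^sup>2) * (\<integral>\<^sup>+\<omega>. ennreal ((X (p, \<omega>) - c p)\<^sup>2) \<partial>M p)"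
        by (rule nn_integral_cmult) measurable
      also have "\<dots> \<le> ennreal (1 / e\<^sup>2) * ennreal (max 0 (v p))"
        using elim by (intro mult_left_mono) (auto simp: max_def ennreal_neg split: if_splits)
      also have "\<dots> = ennreal (max 0 (v p) / e\<^sup>2)"
        by (subst ennreal_mult[symmetric]) auto
      finally have le: "emeasure (M p) (A p) \<le> ennreal (max 0 (v p) / e\<^sup>2)" .
      show ?case
        unfolding measure_def by (rule enn2real_leI[OF _ le]) simp
    qed
    have "(\<lambda>p. max 0 (v p) / e\<^sup>2) \<longlonglongrightarrow> 0"
      using tendsto_divide[OF tendsto_max[OF tendsto_const v] tendsto_const, of "e\<^sup>2" 0] e by simp
    from tendsto_sandwich[OF _ bound tendsto_const this]
    have "(\<lambda>p. measure (M p) (A p)) \<longlonglongrightarrow> 0" by simp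
    moreover have "\<forall>\<^sub>F p in sequentially. \<forall>\<omega> \<in> space (M p) - A p. dist (X (p, \<omega>) - c p) 0 < e"
      using X by eventually_elim (simp add: A_def not_le[symmetric])
    ultimately show "\<forall>\<^sub>F z in in_prob M. dist (X z - c (fst z)) 0 < e"
      unfolding eventually_in_prob fst_conv using A by blast
  qed
  from tendsto_add[OF this tendsto_in_prob_fst[OF c]] show ?thesis by simp
qed

text \<open>Bounded convergence: outside the exceptional event the integrand is within e / 2 of the
  limit, and on it the deviation is at most B + |l|, weighted by a vanishing probability.\<close>

lemma tendsto_integral_in_prob:
  fixes X :: "nat \<times> 'a \<Rightarrow> real"
  assumes X: "(X \<longlongrightarrow> l) (in_prob M)"
    and M: "\<forall>\<^sub>F p in sequentially. prob_space (M p) \<and> (\<lambda>\<omega>. X (p, \<omega>)) \<in> borel_measurable (M p)"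
    and B: "\<And>z. \<bar>X z\<bar> \<le> B"
  shows "(\<lambda>p. \<integral>\<omega>. X (p, \<omega>) \<partial>M p) \<longlonglongrightarrow> l"
proof (rule tendstoI)
  fix e :: real assume e: "0 < e"
  have "\<forall>\<^sub>F z in in_prob M. dist (X z) l < e / 2"
    using e by (intro tendstoD[OF X]) simp
  then obtain A where A: "\<And>p. A p \<in> sets (M p)" "(\<lambda>p. measure (M p) (A p)) \<longlonglongrightarrow> 0"
    and close: "\<forall>\<^sub>F p in sequentially. \<forall>\<omega> \<in> space (M p) - A p. dist (X (p, \<omega>)) l < e / 2"
    unfolding eventually_in_prob by blast
  define C where "C = B + \<bar>l\<bar>"
  have "(\<lambda>p. C * measure (M p) (A p)) \<longlonglongrightarrow> 0"
    using tendsto_mult_right_zero[OF A(2)] .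
  from order_tendstoD(2)[OF this, of "e / 2"] e
  have "\<forall>\<^sub>F p in sequentially. C * measure (M p) (A p) < e / 2" by simp
  with close M show "\<forall>\<^sub>F p in sequentially. dist (\<integral>\<omega>. X (p, \<omega>) \<partial>M p) l < e"
  proof eventually_elim
    case (elim p)
    then interpret prob_space "M p" by simp
    have [measurable]: "(\<lambda>\<omega>. X (p, \<omega>)) \<in> borel_measurable (M p)" "A p \<in> sets (M p)" using elim A by auto
    have int: "integrable (M p) (\<lambda>\<omega>. X (p, \<omega>))"
      using B by (intro integrable_const_bound[of _ B]) auto
    have "\<bar>(\<integral>\<omega>. X (p, \<omega>) \<partial>M p) - l\<bar> = \<bar>\<integral>\<omega>. X (p, \<omega>) - l \<partial>M p\<bar>"
      using int by (subst Bochner_Integration.integral_diff) (auto simp: prob_space)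
    also have "\<dots> \<le> (\<integral>\<omega>. \<bar>X (p, \<omega>) - l\<bar> \<partial>M p)"
      by (rule integral_abs_bound)
    also have "\<dots> \<le> (\<integral>\<omega>. e / 2 + C * indicator (A p) \<omega> \<partial>M p)"
    proof (rule integral_mono)
      show "integrable (M p) (\<lambda>\<omega>. \<bar>X (p, \<omega>) - l\<bar>)" using int by auto
      show "integrable (M p) (\<lambda>\<omega>. e / 2 + C * indicator (A p) \<omega>)" by (simp add: emeasure_eq_measure)
      fix \<omega> assume "\<omega> \<in> space (M p)"
      then show "\<bar>X (p, \<omega>) - l\<bar> \<le> e / 2 + C * indicator (A p) \<omega>"
        using elim(1) B[of "(p, \<omega>)"] e by (cases "\<omega> \<in> A p") (auto simp: C_def dist_real_def less_imp_le)
    qed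
    also have "\<dots> = e / 2 + C * measure (M p) (A p)"
      by (subst Bochner_Integration.integral_add) (auto simp: prob_space emeasure_eq_measure)
    also have "\<dots> < e" using elim by simp
    finally show ?case by (simp add: dist_real_def)
  qed
qed

section \<open>Inner products of independent Gaussian vectors\<close>

lemma (in product_prob_space) integral_coordinate_pair:
  fixes f g :: "'a \<Rightarrow> real"
  assumes I: "finite I" "i \<in> I" "j \<in> I" "i \<noteq> j"
    and f: "integrable (M i) f" and g: "integrable (M j) g"
  shows "integrable (PiM I M) (\<lambda>x. f (x i) * g (x j))"
    and "(\<integral>x. f (x i) * g (x j) \<partial>PiM I M) = (\<integral>x. f x \<partial>M i) * (\<integral>x. g x \<partial>M j)"
proof -
  \<comment> \<open>The factorisation of integrals concerns a product over all coordinates; the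
    coordinates other than i and j receive the constant 1.\<close>
  define h where "h k = (if k = i then f else if k = j then g else (\<lambda>_. 1))" for k
  have h: "integrable (M k) (h k)" for k
    using f g by (auto simp: h_def)
  have I': "I = insert i (insert j (I - {i, j}))" using I by auto
  have prod: "(\<Prod>k\<in>I. h k (x k)) = f (x i) * g (x j)" for x
    using I by (subst I') (simp add: h_def prod.insert_remove)
  show "integrable (PiM I M) (\<lambda>x. f (x i) * g (x j))"
    using product_integrable_prod[of I h] h I by (simp add: prod)
  have "(\<Prod>k\<in>I. integral\<^sup>L (M k) (h k)) = (\<integral>x. f x \<partial>M i) * (\<integral>x. g x \<partial>M j)"
    using I by (subst I') (simp add: h_def prod.insert_remove M.prob_space)
  then show "(\<integral>x. f (x i) * g (x j) \<partial>PiM I M) = (\<integral>x. f x \<partial>M i) * (\<integral>x. g x \<partial>M j)"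
    using product_integral_prod[of I h] h I by (simp add: prod)
qed

text \<open>Expanding the square, the cross terms vanish by independence and mean zero. The function
  f is kept general because two cases are needed: f x = x for inner products with a fixed vector,
  and f x = x^2 - s^2 for the fluctuation of the squared norm.\<close>

lemma nn_integral_square_weighted_sum:
  fixes f :: "'a \<Rightarrow> real" and u :: "'i \<Rightarrow> real"
  assumes N: "prob_space N" and I: "finite I" 
    and f[measurable]: "f \<in> borel_measurable N" and f2: "integrable N (\<lambda>x. (f x)\<^sup>2)"
    and mean: "(\<integral>x. f x \<partial>N) = 0" and var: "(\<integral>x. (f x)\<^sup>2 \<partial>N) = v"
  shows "(\<integral>\<^sup>+x. ennreal ((\<Sum>i\<in>I. u i * f (x i))\<^sup>2) \<partial>PiM I (\<lambda>_. N)) = ennreal (v * (\<Sum>i\<in>I. (u i)\<^sup>2))"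
proof -
  interpret N: prob_space N by fact
  interpret product_prob_space "\<lambda>_::'i. N" by (rule product_prob_spaceI) fact
  have f1: "integrable N f"
    by (rule N.square_integrable_imp_integrable) fact+
  have pair: "integrable (PiM I (\<lambda>_. N)) (\<lambda>x. f (x i) * f (x j)) \<and>
     (\<integral>x. f (x i) * f (x j) \<partial>PiM I (\<lambda>_. N)) = (if i = j then v else 0)" if ij: "i \<in> I" "j \<in> I" for i j
  proof (cases "i = j")
    case True
    have "has_bochner_integral (distr (PiM I (\<lambda>_. N)) N (\<lambda>x. x i)) (\<lambda>x. (f x)\<^sup>2) v"
      unfolding distr_PiM_component[of I "\<lambda>_. N", OF N ij(1)] using f2 var
      by (simp add: has_bochner_integral_iff)
    then show ?thesis
      using ij True by (simp add: has_bochner_integral_iff integrable_distr_eq integral_distr power2_eq_square)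
  next
    case False
    then show ?thesis using integral_coordinate_pair[OF I ij False f1 f1] mean by simp
  qed
  have eq: "(\<Sum>i\<in>I. u i * f (x i))\<^sup>2 = (\<Sum>i\<in>I. \<Sum>j\<in>I. (u i * u j) * (f (x i) * f (x j)))" for x
    by (simp add: power2_eq_square sum_product mult_ac)
  have "integrable (PiM I (\<lambda>_. N)) (\<lambda>x. (\<Sum>i\<in>I. u i * f (x i))\<^sup>2)"
    unfolding eq using pair by (intro Bochner_Integration.integrable_sum integrable_mult_right) auto
  moreover have "(\<integral>x. (\<Sum>i\<in>I. u i * f (x i))\<^sup>2 \<partial>PiM I (\<lambda>_. N)) = v * (\<Sum>i\<in>I. (u i)\<^sup>2)"
  proof -
    have "(\<integral>x. (\<Sum>i\<in>I. u i * f (x i))\<^sup>2 \<partial>PiM I (\<lambda>_. N)) = (\<Sum>i\<in>I. \<Sum>j\<in>I. (u i * u j) * (if i = j then v else 0))"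
      unfolding eq using pair
      by (subst Bochner_Integration.integral_sum, simp, intro sum.cong refl,
          subst Bochner_Integration.integral_sum) (auto intro!: sum.cong)
    also have "\<dots> = (\<Sum>i\<in>I. v * (u i)\<^sup>2)"
      using I by (intro sum.cong refl) (simp add: if_distrib power2_eq_square mult_ac cong: if_cong)
    finally show ?thesis by (simp add: sum_distrib_left)
  qed
  ultimately show ?thesis
    by (subst nn_integral_eq_integral) auto
qed

lemma gauss_moments:
  assumes s: "0 < s"
  shows "integrable (gauss s) (\<lambda>x. x\<^sup>2)" "(\<integral>x. x \<partial>gauss s) = 0" "(\<integral>x. x\<^sup>2 \<partial>gauss s) = s\<^sup>2"
    "integrable (gauss s) (\<lambda>x. (x\<^sup>2 - s\<^sup>2)\<^sup>2)" "(\<integral>x. x\<^sup>2 - s\<^sup>2 \<partial>gauss s) = 0"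
    "(\<integral>x. (x\<^sup>2 - s\<^sup>2)\<^sup>2 \<partial>gauss s) = 2 * s ^ 4"
proof -
  interpret prob_space "gauss s" using s by (rule prob_space_gauss)
  have [simp]: "prob UNIV = 1" using prob_space by simp
  have to_lborel: "has_bochner_integral (gauss s) f c" 
    if "has_bochner_integral lborel (\<lambda>x. normal_density 0 s x * f x) c" "f \<in> borel_measurable borel" for f :: "real \<Rightarrow> real" and c
    using that unfolding gauss_def by (intro has_bochner_integral_density) auto
  have m1: "has_bochner_integral (gauss s) (\<lambda>x. x) 0"
    using normal_moment_odd[OF s, of 0 0] by (intro to_lborel) auto
  have m2: "has_bochner_integral (gauss s) (\<lambda>x. x\<^sup>2) (s\<^sup>2)"
    using normal_moment_even[OF s, of 0 1] by (intro to_lborel) auto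
  \<comment> \<open>The fourth moment enters through the variance of x^2, which is 3 s^4 - 2 s^4 +
    s^4 = 2 s^4.\<close>
  have m4: "has_bochner_integral (gauss s) (\<lambda>x. x ^ 4) (3 * s ^ 4)"
    using normal_moment_even[OF s, of 0 2] by (intro to_lborel) (auto simp: fact_numeral power_divide)
  show "integrable (gauss s) (\<lambda>x. x\<^sup>2)" "(\<integral>x. x \<partial>gauss s) = 0" "(\<integral>x. x\<^sup>2 \<partial>gauss s) = s\<^sup>2"
    using m1 m2 by (auto simp: has_bochner_integral_iff)
  show "(\<integral>x. x\<^sup>2 - s\<^sup>2 \<partial>gauss s) = 0"
    using m2 by (simp add: has_bochner_integral_iff prob_space)
  have eq: "(x\<^sup>2 - s\<^sup>2)\<^sup>2 = x ^ 4 - 2 * s\<^sup>2 * x\<^sup>2 + s ^ 4" for x :: real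
    by (simp add: power2_eq_square power4_eq_xxxx algebra_simps)
  show "integrable (gauss s) (\<lambda>x. (x\<^sup>2 - s\<^sup>2)\<^sup>2)" "(\<integral>x. (x\<^sup>2 - s\<^sup>2)\<^sup>2 \<partial>gauss s) = 2 * s ^ 4"
    unfolding eq using m2 m4
    by (auto simp: has_bochner_integral_iff prob_space power2_eq_square power4_eq_xxxx)
qed

lemma nn_integral_dot_gauss_vec:
  assumes s: "0 < s"
  shows "(\<integral>\<^sup>+x. ennreal ((dot p u x)\<^sup>2) \<partial>gauss_vec p s) = ennreal (s\<^sup>2 * dot p u u)"
  using nn_integral_square_weighted_sum[OF prob_space_gauss[OF s] finite_lessThan, where f = "\<lambda>x. x" and u = u] gauss_moments[OF s]
  by (simp add: gauss_vec_def dot_def power2_eq_square)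

lemma nn_integral_norm_gauss_vec:
  assumes s: "0 < s"
  shows "(\<integral>\<^sup>+x. ennreal ((dot p x x - p * s\<^sup>2)\<^sup>2) \<partial>gauss_vec p s) = ennreal (2 * s ^ 4 * p)"
  using nn_integral_square_weighted_sum[OF prob_space_gauss[OF s] finite_lessThan, where f = "\<lambda>x. x\<^sup>2 - s\<^sup>2" and u = "\<lambda>_. 1"]
    gauss_moments[OF s]
  by (simp add: gauss_vec_def dot_def sum_subtractf power2_eq_square)

lemma dot_measurable [measurable]:
  assumes "\<And>i. i < p \<Longrightarrow> (\<lambda>w. x w i) \<in> borel_measurable M" "\<And>i. i < p \<Longrightarrow> (\<lambda>w. y w i) \<in> borel_measurable M"
  shows "(\<lambda>w. dot p (x w) (y w)) \<in> borel_measurable M"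
  unfolding dot_def using assms by (intro borel_measurable_sum borel_measurable_times) auto

text \<open>For fixed x the inner integral is t^2 |x|^2, and the mean of |x|^2 is p s^2.\<close>

lemma nn_integral_dot_gauss_vec_pair:
  assumes s: "0 < s" and t: "0 < t"
  shows "(\<integral>\<^sup>+x. \<integral>\<^sup>+y. ennreal ((dot p x y)\<^sup>2) \<partial>gauss_vec p t \<partial>gauss_vec p s) = ennreal (p * s\<^sup>2 * t\<^sup>2)"
proof -
  have [measurable]: "(\<lambda>x. x i) \<in> borel_measurable (gauss_vec p s)" if "i < p" for i
    using that unfolding measurable_cong_sets[OF sets_gauss_vec refl]
    by (intro measurable_component_singleton) simp
  have "(\<integral>\<^sup>+x. \<integral>\<^sup>+y. ennreal ((dot p x y)\<^sup>2) \<partial>gauss_vec p t \<partial>gauss_vec p s) =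
      (\<integral>\<^sup>+x. (\<Sum>i<p. ennreal (t\<^sup>2) * ennreal ((x i)\<^sup>2)) \<partial>gauss_vec p s)"
    unfolding nn_integral_dot_gauss_vec[OF t]
    by (intro nn_integral_cong) (simp add: dot_def sum_distrib_left power2_eq_square ennreal_mult'[symmetric])
  also have "\<dots> = (\<Sum>i<p. ennreal (t\<^sup>2) * (\<integral>\<^sup>+x. ennreal ((x i)\<^sup>2) \<partial>gauss_vec p s))"
    by (subst nn_integral_sum) (auto simp: nn_integral_cmult)
  also have "\<dots> = (\<Sum>i<p. ennreal (t\<^sup>2 * s\<^sup>2))"
  proof (intro sum.cong refl)
    fix i assume i: "i \<in> {..<p}"
    \<comment> \<open>A coordinate is the inner product with a unit vector, so its second moment is
      a case of the formula for fixed vectors.\<close>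
    have "dot p (\<lambda>k. if k = i then 1 else 0) x = x i" for x
      using i unfolding dot_def by (subst sum.remove[of _ i]) auto
    then have "(\<integral>\<^sup>+x. ennreal ((x i)\<^sup>2) \<partial>gauss_vec p s) = ennreal (s\<^sup>2)"
      using nn_integral_dot_gauss_vec[OF s, of p "\<lambda>k. if k = i then 1 else 0"] i by simp
    then show "ennreal (t\<^sup>2) * (\<integral>\<^sup>+x. ennreal ((x i)\<^sup>2) \<partial>gauss_vec p s) = ennreal (t\<^sup>2 * s\<^sup>2)"
      by (simp add: ennreal_mult)
  qed
  finally show ?thesis by (simp add: ennreal_of_nat_eq_real_of_nat ennreal_mult'[symmetric] mult_ac)
qed

section \<open>The Gram matrix of the five vectors\<close>

text \<open>Precision of the r-th vector of \<open>vecs\<close> below; the entry for the deterministic vector r = 0 is a dummy.\<close>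
definition precision :: "(nat \<Rightarrow> nat) \<Rightarrow> (nat \<Rightarrow> real) \<Rightarrow> nat \<Rightarrow> real" where
  "precision n nu r = [1, nu 0, nu 1, real (n 0), real (n 1)] ! r"

text \<open>Numbering the deterministic vector and the four random ones allows a single limit
  statement to cover all entries of their Gram matrix.\<close>

definition vecs :: "(nat \<Rightarrow> real) \<Rightarrow> (nat \<Rightarrow> real) \<times> (nat \<Rightarrow> real) \<times> (nat \<Rightarrow> real) \<times> (nat \<Rightarrow> real) \<Rightarrow>
    nat \<Rightarrow> nat \<Rightarrow> real" where
  "vecs u z r = (case z of (a0, a1, b0, b1) \<Rightarrow> [u, a0, a1, b0, b1] ! r)"

lemma less_5_cases:
  fixes r :: nat
  assumes "r < 5"
  obtains "r = 0" | "r = 1" | "r = 2" | "r = 3" | "r = 4"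
  using assms by linarith

lemma nn_integral_pair4:
  assumes "prob_space A" "prob_space B" "prob_space C" "prob_space D"
    and f[measurable]: "f \<in> borel_measurable (A \<Otimes>\<^sub>M (B \<Otimes>\<^sub>M (C \<Otimes>\<^sub>M D)))"
  shows "(\<integral>\<^sup>+z. f z \<partial>(A \<Otimes>\<^sub>M (B \<Otimes>\<^sub>M (C \<Otimes>\<^sub>M D)))) =
    (\<integral>\<^sup>+a. \<integral>\<^sup>+b. \<integral>\<^sup>+c. \<integral>\<^sup>+d. f (a, b, c, d) \<partial>D \<partial>C \<partial>B \<partial>A)"
proof -
  have CD: "prob_space (C \<Otimes>\<^sub>M D)" and BCD: "prob_space (B \<Otimes>\<^sub>M (C \<Otimes>\<^sub>M D))"
    using assms by (auto intro!: prob_space_pair)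
  interpret D: prob_space D by fact
  interpret CD: prob_space "C \<Otimes>\<^sub>M D" by fact
  interpret BCD: prob_space "B \<Otimes>\<^sub>M (C \<Otimes>\<^sub>M D)" by fact
  have "(\<integral>\<^sup>+z. f z \<partial>(A \<Otimes>\<^sub>M (B \<Otimes>\<^sub>M (C \<Otimes>\<^sub>M D)))) = (\<integral>\<^sup>+a. \<integral>\<^sup>+z. f (a, z) \<partial>(B \<Otimes>\<^sub>M (C \<Otimes>\<^sub>M D)) \<partial>A)"
    by (rule BCD.nn_integral_fst[symmetric]) measurable
  also have "\<dots> = (\<integral>\<^sup>+a. \<integral>\<^sup>+b. \<integral>\<^sup>+z. f (a, b, z) \<partial>(C \<Otimes>\<^sub>M D) \<partial>B \<partial>A)"
  proof (rule nn_integral_cong)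
    fix a assume [measurable]: "a \<in> space A"
    show "(\<integral>\<^sup>+z. f (a, z) \<partial>(B \<Otimes>\<^sub>M (C \<Otimes>\<^sub>M D))) = (\<integral>\<^sup>+b. \<integral>\<^sup>+z. f (a, b, z) \<partial>(C \<Otimes>\<^sub>M D) \<partial>B)"
      by (rule CD.nn_integral_fst[symmetric]) measurable
  qed
  also have "\<dots> = (\<integral>\<^sup>+a. \<integral>\<^sup>+b. \<integral>\<^sup>+c. \<integral>\<^sup>+d. f (a, b, c, d) \<partial>D \<partial>C \<partial>B \<partial>A)"
  proof (intro nn_integral_cong)
    fix a b assume [measurable]: "a \<in> space A" "b \<in> space B"
    show "(\<integral>\<^sup>+z. f (a, b, z) \<partial>(C \<Otimes>\<^sub>M D)) = (\<integral>\<^sup>+c. \<integral>\<^sup>+d. f (a, b, c, d) \<partial>D \<partial>C)"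
      by (rule D.nn_integral_fst[symmetric]) measurable
  qed
  finally show ?thesis .
qed

context
  fixes p :: nat and n :: "nat \<Rightarrow> nat" and nu :: "nat \<Rightarrow> real"
  assumes pos: "0 < nu 0" "0 < nu 1" "0 < n 0" "0 < n 1"
begin

lemma prob_space_whitened: "prob_space (whitened p n nu)"
  unfolding whitened_def using pos by (intro prob_space_pair prob_space_gauss_vec) auto

lemma precision_pos: "r < 5 \<Longrightarrow> 0 < precision n nu r"
  using pos by (elim less_5_cases) (auto simp: precision_def)

private abbreviation "gv r \<equiv> gauss_vec p (1 / sqrt (precision n nu r))"
private abbreviation "P \<equiv> PiM {..<p} (\<lambda>_. borel :: real measure)"

lemma whitened_precision: "whitened p n nu = gv 1 \<Otimes>\<^sub>M (gv 2 \<Otimes>\<^sub>M (gv 3 \<Otimes>\<^sub>M gv 4))"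
  by (simp add: whitened_def precision_def)

lemma vecs_coordinate_measurable:
  assumes "r < 5" "i < p"
  shows "(\<lambda>z. vecs u z r i) \<in> borel_measurable (whitened p n nu)"
proof -
  have [measurable]: "(\<lambda>x. x i) \<in> borel_measurable P"
    using assms by (intro measurable_component_singleton) auto
  have "(\<lambda>z. vecs u z r i) \<in> borel_measurable (P \<Otimes>\<^sub>M (P \<Otimes>\<^sub>M (P \<Otimes>\<^sub>M P)))"
    using assms(1) by (cases rule: less_5_cases) (simp_all add: vecs_def case_prod_beta')
  then show ?thesis unfolding whitened_def by measurable
qed

text \<open>After splitting the fourfold product by Tonelli, the two vectors that do not occur
  integrate to 1.\<close>

lemma nn_integral_vecs_pair:
  assumes rq: "0 < r" "r < q" "q < 5" and f: "(\<lambda>(x, y). f x y) \<in> borel_measurable (P \<Otimes>\<^sub>M P)"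
  shows "(\<integral>\<^sup>+z. f (vecs u z r) (vecs u z q) \<partial>whitened p n nu) = (\<integral>\<^sup>+x. \<integral>\<^sup>+y. f x y \<partial>gv q \<partial>gv r)"
proof -
  have ps: "prob_space (gv 1)" "prob_space (gv 2)" "prob_space (gv 3)" "prob_space (gv 4)"
    using precision_pos by (auto intro!: prob_space_gauss_vec)
  interpret G1: prob_space "gv 1" by fact
  interpret G2: prob_space "gv 2" by fact
  interpret G3: prob_space "gv 3" by fact
  interpret G4: prob_space "gv 4" by fact
  have G1': "emeasure (gv (Suc 0)) (space (gv (Suc 0))) = 1"
    using G1.emeasure_space_1 by simp
  have f': "(\<lambda>w. f (x w) (y w)) \<in> borel_measurable M" if "x \<in> measurable M P" "y \<in> measurable M P" for x y and M :: "'b measure"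
    using measurable_compose[OF measurable_Pair[OF that] f] by simp
  have "r = 1 \<and> (q = 2 \<or> q = 3 \<or> q = 4) \<or> r = 2 \<and> (q = 3 \<or> q = 4) \<or> r = 3 \<and> q = 4"
    using rq by linarith
  then show ?thesis
    unfolding whitened_precision
    by (elim disjE conjE; simp only:; subst nn_integral_pair4[OF ps])
      (auto simp: vecs_def case_prod_beta' G1' G2.emeasure_space_1 G3.emeasure_space_1
        G4.emeasure_space_1 intro!: f')
qed

lemma nn_integral_vecs:
  assumes r: "0 < r" "r < 5" and f: "f \<in> borel_measurable P"
  shows "(\<integral>\<^sup>+z. f (vecs u z r) \<partial>whitened p n nu) = (\<integral>\<^sup>+x. f x \<partial>gv r)"
proof -
  have ps: "prob_space (gv 1)" "prob_space (gv 2)" "prob_space (gv 3)" "prob_space (gv 4)"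
    using precision_pos by (auto intro!: prob_space_gauss_vec)
  interpret G1: prob_space "gv 1" by fact
  interpret G2: prob_space "gv 2" by fact
  interpret G3: prob_space "gv 3" by fact
  interpret G4: prob_space "gv 4" by fact
  have G1': "emeasure (gv (Suc 0)) (space (gv (Suc 0))) = 1"
    using G1.emeasure_space_1 by simp
  have f': "(\<lambda>w. f (x w)) \<in> borel_measurable M" if "x \<in> measurable M P" for x and M :: "'b measure"
    using measurable_compose[OF that f] .
  have "r = 1 \<or> r = 2 \<or> r = 3 \<or> r = 4"
    using r by linarith
  then show ?thesis
    unfolding whitened_precision
    by (elim disjE; simp only:; subst nn_integral_pair4[OF ps])
      (auto simp: vecs_def case_prod_beta' G1' G2.emeasure_space_1 G3.emeasure_space_1
        G4.emeasure_space_1 intro!: f')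
qed

private lemma dot_P_measurable:
  "(\<lambda>x. dot p v x) \<in> borel_measurable P" "(\<lambda>x. dot p x x) \<in> borel_measurable P"
  "(\<lambda>(x, y). dot p x y) \<in> borel_measurable (P \<Otimes>\<^sub>M P)"
proof -
  have c[measurable]: "(\<lambda>x. x i) \<in> borel_measurable P" if "i < p" for i
    using that by (intro measurable_component_singleton) auto
  show "(\<lambda>x. dot p v x) \<in> borel_measurable P" "(\<lambda>x. dot p x x) \<in> borel_measurable P"
    by (rule dot_measurable; simp add: c)+
  show "(\<lambda>(x, y). dot p x y) \<in> borel_measurable (P \<Otimes>\<^sub>M P)"
    unfolding case_prod_beta'
    by (rule dot_measurable)
      (auto intro: measurable_compose[OF measurable_fst c] measurable_compose[OF measurable_snd c])
qed

lemma nn_integral_dot_vecs: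
  shows "0 < r \<Longrightarrow> r < 5 \<Longrightarrow>
      (\<integral>\<^sup>+z. ennreal ((dot p v (vecs u z r))\<^sup>2) \<partial>whitened p n nu) = ennreal (dot p v v / precision n nu r)"
    and "0 < r \<Longrightarrow> r < 5 \<Longrightarrow>
      (\<integral>\<^sup>+z. ennreal ((dot p (vecs u z r) (vecs u z r) - p / precision n nu r)\<^sup>2) \<partial>whitened p n nu) =
      ennreal (2 * (p / precision n nu r / precision n nu r))"
    and "0 < r \<Longrightarrow> r < q \<Longrightarrow> q < 5 \<Longrightarrow>
      (\<integral>\<^sup>+z. ennreal ((dot p (vecs u z r) (vecs u z q))\<^sup>2) \<partial>whitened p n nu) =
      ennreal (p / precision n nu r / precision n nu q)"
proof -
  have sq: "(1 / sqrt (precision n nu r))\<^sup>2 = 1 / precision n nu r" "0 < 1 / sqrt (precision n nu r)" if "r < 5" for r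
    using precision_pos[OF that] by (simp_all add: power_divide)
  note [measurable] = dot_P_measurable
  show "(\<integral>\<^sup>+z. ennreal ((dot p v (vecs u z r))\<^sup>2) \<partial>whitened p n nu) = ennreal (dot p v v / precision n nu r)"
    if "0 < r" "r < 5"
    using nn_integral_vecs[OF that, of "\<lambda>x. ennreal ((dot p v x)\<^sup>2)" u]
      nn_integral_dot_gauss_vec[OF sq(2)[OF that(2)], of p v] sq(1)[OF that(2)] by simp
  show "(\<integral>\<^sup>+z. ennreal ((dot p (vecs u z r) (vecs u z r) - p / precision n nu r)\<^sup>2) \<partial>whitened p n nu) =
      ennreal (2 * (p / precision n nu r / precision n nu r))"
    if "0 < r" "r < 5"
  proof -
    have "2 * (1 / sqrt (precision n nu r)) ^ 4 * p = 2 * ((1 / sqrt (precision n nu r))\<^sup>2)\<^sup>2 * p"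
      by simp
    then have "2 * (1 / sqrt (precision n nu r)) ^ 4 * p = 2 * (p / precision n nu r / precision n nu r)"
      unfolding sq(1)[OF that(2)] by (simp add: power2_eq_square)
    then show ?thesis
      using nn_integral_vecs[OF that, of "\<lambda>x. ennreal ((dot p x x - p / precision n nu r)\<^sup>2)" u]
        nn_integral_norm_gauss_vec[OF sq(2)[OF that(2)], of p] sq(1)[OF that(2)] by simp
  qed
  show "(\<integral>\<^sup>+z. ennreal ((dot p (vecs u z r) (vecs u z q))\<^sup>2) \<partial>whitened p n nu) =
      ennreal (p / precision n nu r / precision n nu q)" if "0 < r" "r < q" "q < 5"
  proof -
    have "r < 5" using that by simp
    have "(\<lambda>(x, y). ennreal ((dot p x y)\<^sup>2)) \<in> borel_measurable (P \<Otimes>\<^sub>M P)"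
      using dot_P_measurable(3) unfolding case_prod_beta' by measurable
    from nn_integral_vecs_pair[OF that this, of u] show ?thesis
      using nn_integral_dot_gauss_vec_pair[OF sq(2)[OF \<open>r < 5\<close>] sq(2)[OF \<open>q < 5\<close>], of p]
        sq(1)[OF \<open>r < 5\<close>] sq(1)[OF \<open>q < 5\<close>] by simp
  qed
qed

end

lemma dot_commute: "dot p x y = dot p y x"
  by (simp add: dot_def mult.commute)

text \<open>The Gram matrix becomes diagonal in the limit. With precisions k and k', the mean square
  deviations are |u|^2 / k for the fixed vector against a random one, 2 p / k^2 for a squared norm
  around p / k, and p / (k k') for two random vectors. Each is a convergent factor times the
  reciprocal of a precision, up to a constant.\<close>

lemma tendsto_dot_vecs:
  assumes pos: "\<forall>\<^sub>F p in sequentially. 0 < nu p 0 \<and> 0 < nu p 1 \<and> 0 < n p 0 \<and> 0 < n p 1"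
    and precision: "\<And>r. 0 < r \<Longrightarrow> r < 5 \<Longrightarrow> filterlim (\<lambda>p. precision (n p) (nu p) r) at_top sequentially"
    and lim: "\<And>r. 0 < r \<Longrightarrow> r < 5 \<Longrightarrow> (\<lambda>p. real p / precision (n p) (nu p) r) \<longlonglongrightarrow> l r"
    and u: "(\<lambda>p. dot p (u p) (u p)) \<longlonglongrightarrow> l 0"
    and r: "r < 5" and q: "q < 5"
  shows "((\<lambda>z. dot (fst z) (vecs (u (fst z)) (snd z) r) (vecs (u (fst z)) (snd z) q)) \<longlongrightarrow>
      (if r = q then l r else 0)) (in_prob (\<lambda>p. whitened p (n p) (nu p)))"
  using r q
proof (induction r q rule: linorder_wlog)
  case (sym r q)
  have eq: "(\<lambda>z. dot (fst z) (vecs (u (fst z)) (snd z) q) (vecs (u (fst z)) (snd z) r)) =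
      (\<lambda>z. dot (fst z) (vecs (u (fst z)) (snd z) r) (vecs (u (fst z)) (snd z) q))"
    by (rule ext) (rule dot_commute)
  from sym show ?case unfolding eq by (cases "q = r") auto
next
  case (le r q)
  let ?M = "\<lambda>p. whitened p (n p) (nu p)"
  let ?X = "\<lambda>z. dot (fst z) (vecs (u (fst z)) (snd z) r) (vecs (u (fst z)) (snd z) q)"
  have meas: "(\<lambda>z. ?X (p, z)) \<in> borel_measurable (?M p)"
    if "0 < nu p 0 \<and> 0 < nu p 1 \<and> 0 < n p 0 \<and> 0 < n p 1" for p
    using that le by (auto intro!: dot_measurable vecs_coordinate_measurable)
  have inv: "(\<lambda>p. 1 / precision (n p) (nu p) r) \<longlonglongrightarrow> 0" if "0 < r" "r < 5" for r
    using tendsto_inverse_0_at_top[OF precision[OF that]] by (simp add: divide_inverse)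
  consider "r = 0" "q = 0" | "r = 0" "0 < q" | "0 < r" "r = q" | "0 < r" "r < q"
    using le by linarith
  then show ?case
  proof cases
    case 1
    then show ?thesis
      using tendsto_in_prob_fst[OF u, of ?M] by (simp add: vecs_def case_prod_beta')
  next
    case 2
    have v0: "vecs v z 0 = v" for v z
      by (simp add: vecs_def case_prod_beta')
    have "(?X \<longlongrightarrow> 0) (in_prob ?M)"
    proof (rule tendsto_in_prob_L2[where c = "\<lambda>_. 0"])
      show "(\<lambda>p. dot p (u p) (u p) * (1 / precision (n p) (nu p) q)) \<longlonglongrightarrow> 0"
        using tendsto_mult[OF u inv[of q]] 2 le by simp
      show "\<forall>\<^sub>F p in sequentially. (\<lambda>z. ?X (p, z)) \<in> borel_measurable (?M p) \<and>
         (\<integral>\<^sup>+z. ennreal ((?X (p, z) - 0)\<^sup>2) \<partial>?M p) \<le> ennreal (dot p (u p) (u p) * (1 / precision (n p) (nu p) q))"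
        using pos
      proof eventually_elim
        case (elim p)
        then show ?case
          using meas[OF elim] 2 le by (auto simp: v0 nn_integral_dot_vecs)
      qed
    qed simp
    then show ?thesis using 2 by simp
  next
    case 3
    have "(?X \<longlongrightarrow> l r) (in_prob ?M)"
    proof (rule tendsto_in_prob_L2[OF _ _ lim])
      show "(\<lambda>p. 2 * (real p / precision (n p) (nu p) r * (1 / precision (n p) (nu p) r))) \<longlonglongrightarrow> 0"
        using tendsto_mult[OF tendsto_const tendsto_mult[OF lim[of r] inv[of r]], of 2] 3 le by simp
      show "\<forall>\<^sub>F p in sequentially. (\<lambda>z. ?X (p, z)) \<in> borel_measurable (?M p) \<and>
         (\<integral>\<^sup>+z. ennreal ((?X (p, z) - real p / precision (n p) (nu p) r)\<^sup>2) \<partial>?M p) \<le>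
           ennreal (2 * (real p / precision (n p) (nu p) r * (1 / precision (n p) (nu p) r)))"
        using pos
      proof eventually_elim
        case (elim p)
        then show ?case
          using meas[OF elim] 3 le by (auto simp: nn_integral_dot_vecs)
      qed
    qed (use 3 le in auto)
    then show ?thesis using 3 by simp
  next
    case 4
    have "(?X \<longlongrightarrow> 0) (in_prob ?M)"
    proof (rule tendsto_in_prob_L2[where c = "\<lambda>_. 0"])
      show "(\<lambda>p. real p / precision (n p) (nu p) r * (1 / precision (n p) (nu p) q)) \<longlonglongrightarrow> 0"
        using tendsto_mult[OF lim[of r] inv[of q]] 4 le by simp
      show "\<forall>\<^sub>F p in sequentially. (\<lambda>z. ?X (p, z)) \<in> borel_measurable (?M p) \<and>
         (\<integral>\<^sup>+z. ennreal ((?X (p, z) - 0)\<^sup>2) \<partial>?M p) \<le>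
           ennreal (real p / precision (n p) (nu p) r * (1 / precision (n p) (nu p) q))"
        using pos
      proof eventually_elim
        case (elim p)
        then show ?case
          using meas[OF elim] 4 le by (auto simp: nn_integral_dot_vecs)
      qed
    qed simp
    then show ?thesis using 4 by simp
  qed
qed

text \<open>In the bilinear expansion only the diagonal terms survive the limit. The coefficients
  may vary along the filter, as required by the posterior weights, which depend on p.\<close>

lemma tendsto_dot_combinations:
  fixes k :: nat
  assumes dot: "\<And>r q. r < k \<Longrightarrow> q < k \<Longrightarrow> ((\<lambda>z. dot (P z) (V z r) (V z q)) \<longlongrightarrow> (if r = q then l r else 0)) F"
    and a: "\<And>r. r < k \<Longrightarrow> ((\<lambda>z. a z r) \<longlongrightarrow> A r) F" and b: "\<And>r. r < k \<Longrightarrow> ((\<lambda>z. b z r) \<longlongrightarrow> B r) F"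
  shows "((\<lambda>z. dot (P z) (\<lambda>i. \<Sum>r<k. a z r * V z r i) (\<lambda>i. \<Sum>q<k. b z q * V z q i)) \<longlongrightarrow>
    (\<Sum>r<k. A r * B r * l r)) F"
proof -
  have "dot p (\<lambda>i. \<Sum>r<k. a r * V r i) (\<lambda>i. \<Sum>q<k. b q * V q i) = (\<Sum>r<k. \<Sum>q<k. a r * b q * dot p (V r) (V q))"
    for p and a b :: "nat \<Rightarrow> real" and V
  proof -
    have "dot p (\<lambda>i. \<Sum>r<k. a r * V r i) (\<lambda>i. \<Sum>q<k. b q * V q i) =
        (\<Sum>i<p. \<Sum>r<k. \<Sum>q<k. a r * b q * (V r i * V q i))"
      by (simp add: dot_def sum_product mult_ac)
    also have "\<dots> = (\<Sum>r<k. \<Sum>i<p. \<Sum>q<k. a r * b q * (V r i * V q i))"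
      by (rule sum.swap)
    also have "\<dots> = (\<Sum>r<k. \<Sum>q<k. \<Sum>i<p. a r * b q * (V r i * V q i))"
      by (intro sum.cong refl sum.swap)
    finally show ?thesis by (simp add: dot_def sum_distrib_left)
  qed
  moreover have "((\<lambda>z. \<Sum>r<k. \<Sum>q<k. a z r * b z q * dot (P z) (V z r) (V z q)) \<longlongrightarrow>
     (\<Sum>r<k. \<Sum>q<k. A r * B q * (if r = q then l r else 0))) F"
    using assms by (intro tendsto_sum tendsto_mult) auto
  moreover have "(\<Sum>r<k. \<Sum>q<k. A r * B q * (if r = q then l r else 0)) = (\<Sum>r<k. A r * B r * l r)"
    by (intro sum.cong refl) (simp add: if_distrib cong: if_cong)
  ultimately show ?thesis by simp
qed

section \<open>The errors as functions of inner products\<close>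

lemma Phi_eq_cdf: "Phi x = cdf std_normal_distribution x"
proof -
  have "cdf std_normal_distribution x = (\<integral>t. indicator {..x} t \<partial>std_normal_distribution)"
    unfolding cdf_def by simp
  also have "\<dots> = (\<integral>t. std_normal_density t * indicator {..x} t \<partial>lborel)"
    by (subst integral_density) auto
  finally show ?thesis
    by (simp add: Phi_def set_lebesgue_integral_def mult.commute)
qed

lemma Phi_bounds: "0 \<le> Phi x" "Phi x \<le> 1"
proof -
  interpret real_distribution std_normal_distribution by (rule real_dist_normal_dist)
  show "0 \<le> Phi x" "Phi x \<le> 1"
    unfolding Phi_eq_cdf by (rule cdf_nonneg, rule cdf_bounded_prob)
qed

lemma isCont_Phi: "isCont Phi x"
proof -
  interpret real_distribution std_normal_distribution by (rule real_dist_normal_dist)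
  have "AE t in lborel. t \<noteq> x"
    by (rule AE_lborel_singleton)
  then have "emeasure std_normal_distribution {x} = 0"
    by (subst emeasure_density) (auto simp: nn_integral_0_iff_AE indicator_def elim: eventually_mono)
  then have "isCont (cdf std_normal_distribution) x"
    by (subst isCont_cdf) (simp add: measure_def)
  moreover have "Phi = cdf std_normal_distribution"
    by (rule ext) (rule Phi_eq_cdf)
  ultimately show ?thesis by simp
qed

lemma Phi_measurable [measurable]: "Phi \<in> borel_measurable borel"
  using isCont_Phi by (intro borel_measurable_continuous_onI) (simp add: continuous_on_eq_continuous_at)

text \<open>The vectors telescope: xbar_i = m_i + (mu_i - m_i) + (xbar_i - mu_i). Every argument of
  a quadratic form in the errors is a combination of means with weights summing to 0, so the prior
  means enter only through m_0 - m_1.\<close>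

definition increment :: "(nat \<Rightarrow> nat \<Rightarrow> real) \<Rightarrow> (nat \<Rightarrow> real) \<Rightarrow> (nat \<Rightarrow> real) \<Rightarrow> (nat \<Rightarrow> real) \<Rightarrow> (nat \<Rightarrow> real) \<Rightarrow>
    nat \<Rightarrow> nat \<Rightarrow> real" where
  "increment m mu0 mu1 x0 x1 r j =
    [m 0 j - m 1 j, mu0 j - m 0 j, mu1 j - m 1 j, x0 j - mu0 j, x1 j - mu1 j] ! r"

definition comb_dot :: "nat \<Rightarrow> (nat \<Rightarrow> nat \<Rightarrow> real) \<Rightarrow> real list \<Rightarrow> real list \<Rightarrow> real" where
  "comb_dot p V a b = dot p (\<lambda>i. \<Sum>r<5. a ! r * V r i) (\<lambda>i. \<Sum>q<5. b ! q * V q i)"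

lemma sum_lessThan_5: "(\<Sum>r<5. f r) = f 0 + f 1 + f 2 + f 3 + f (4::nat)" for f :: "nat \<Rightarrow> real"
  by (simp add: eval_nat_numeral)

text \<open>The whitening map is linear, so a combination of increments is sent to the combination
  of their images with the same coefficients, and the form S^{-1} becomes the ordinary inner
  product.\<close>

lemma bil_increment:
  assumes K: "lower_tri p K" "whitens p K S"
  shows "bil p (mat_inv p S) (\<lambda>j. \<Sum>r<5. a ! r * increment m mu0 mu1 x0 x1 r j) (\<lambda>j. \<Sum>r<5. b ! r * increment m mu0 mu1 x0 x1 r j) =
    comb_dot p (vecs (mat_app p K (\<lambda>j. m 0 j - m 1 j))
      (mat_app p K (\<lambda>j. mu0 j - m 0 j), mat_app p K (\<lambda>j. mu1 j - m 1 j),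
       mat_app p K (\<lambda>j. x0 j - mu0 j), mat_app p K (\<lambda>j. x1 j - mu1 j))) a b"
proof -
  let ?I = "increment m mu0 mu1 x0 x1"
  let ?V = "vecs (mat_app p K (\<lambda>j. m 0 j - m 1 j))
      (mat_app p K (\<lambda>j. mu0 j - m 0 j), mat_app p K (\<lambda>j. mu1 j - m 1 j),
       mat_app p K (\<lambda>j. x0 j - mu0 j), mat_app p K (\<lambda>j. x1 j - mu1 j))"
  have V: "?V r = mat_app p K (?I r)" if "r < 5" for r
    using that by (cases rule: less_5_cases) (simp_all add: vecs_def increment_def[abs_def])
  have *: "(\<Sum>j<p. K i j * (\<Sum>r<5. a ! r * ?I r j)) = (\<Sum>r<5. a ! r * ?V r i)" if "i < p" for i a
  proof -
    have "(\<Sum>j<p. K i j * (\<Sum>r<5. a ! r * ?I r j)) = (\<Sum>r<5. \<Sum>j<p. K i j * (a ! r * ?I r j))"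
      by (simp only: sum_distrib_left) (rule sum.swap)
    also have "\<dots> = (\<Sum>r<5. a ! r * ?V r i)"
    proof (intro sum.cong refl)
      fix r :: nat assume "r \<in> {..<5}"
      then have "?V r i = (\<Sum>j<p. K i j * ?I r j)"
        using that V[of r] by (simp only: mat_app_def restrict_apply lessThan_iff if_True)
      then show "(\<Sum>j<p. K i j * (a ! r * ?I r j)) = a ! r * ?V r i"
        by (simp only: sum_distrib_left mult_ac)
    qed
    finally show ?thesis .
  qed
  show ?thesis
    unfolding bil_mat_inv[OF K] comb_dot_def dot_def by (intro sum.cong refl) (simp add: *)
qed

text \<open>Coordinates of xbar_0 - xbar_1 relative to \<open>increment\<close>: the increments of
  class 0 enter with sign +1, those of class 1 with -1.\<close>

definition diff_coef :: "real list" where "diff_coef = [1, 1, -1, 1, -1]"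

text \<open>Coordinates relative to \<open>increment\<close>: of mu_i - (xbar_0 + xbar_1) / 2 for s = 1, t = 0, and of
  m*_i - (xbar_0 + xbar_1) / 2 for s = t = n_i / (n_i + nu_i).\<close>
definition mid_coef :: "nat \<Rightarrow> real \<Rightarrow> real \<Rightarrow> real list" where
  "mid_coef i s t = (if i = 0 then [1/2, s - 1/2, -1/2, t - 1/2, -1/2] else [-1/2, -1/2, s - 1/2, -1/2, t - 1/2])"

lemma increment_diff: "(\<lambda>k. x0 k - x1 k) = (\<lambda>k. \<Sum>r<5. diff_coef ! r * increment m mu0 mu1 x0 x1 r k)"
  by (simp add: sum_lessThan_5 diff_coef_def increment_def)

lemma increment_true:
  "(\<lambda>k. (if i = 0 then mu0 else mu1) k - (x0 k + x1 k) / 2) =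
    (\<lambda>k. \<Sum>r<5. mid_coef i 1 0 ! r * increment m mu0 mu1 x0 x1 r k)"
  by (auto simp: sum_lessThan_5 mid_coef_def increment_def field_simps)

lemma increment_bayes:
  assumes "0 < real n + nu" "i = 0 \<or> i = 1"
  shows "(\<lambda>k. (real n * (if i = 0 then x0 else x1) k + nu * m i k) / (real n + nu) - (x0 k + x1 k) / 2) =
    (\<lambda>k. \<Sum>r<5. mid_coef i (real n / (real n + nu)) (real n / (real n + nu)) ! r * increment m mu0 mu1 x0 x1 r k)"
proof
  fix k
  define t where "t = real n / (real n + nu)"
  \<comment> \<open>The posterior mean is the prior mean moved by the fraction t towards the sample
    mean. As xbar_i - m_i is the sum of the two increments of class i, both of them get the weight
    t.\<close>
  have eq: "(real n * x + nu * y) / (real n + nu) = y + t * (x - y)" for x y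
    using assms(1) by (simp add: t_def field_simps)
  show "(real n * (if i = 0 then x0 else x1) k + nu * m i k) / (real n + nu) - (x0 k + x1 k) / 2 =
    (\<Sum>r<5. mid_coef i (real n / (real n + nu)) (real n / (real n + nu)) ! r * increment m mu0 mu1 x0 x1 r k)"
    unfolding eq t_def[symmetric] using assms(2) by (auto simp: sum_lessThan_5 mid_coef_def increment_def algebra_simps)
qed

lemma comb_dot_vecs_measurable:
  assumes "0 < nu 0" "0 < nu 1" "0 < n 0" "0 < n 1"
  shows "(\<lambda>z. comb_dot p (vecs u z) a b) \<in> borel_measurable (whitened p n nu)"
  unfolding comb_dot_def
  by (intro dot_measurable borel_measurable_sum borel_measurable_times borel_measurable_const
      vecs_coordinate_measurable[where p = p and n = n and nu = nu]) (use assms in auto)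

text \<open>The limiting inner product for the estimator when the squared norms tend to D, y_i and
  x_i. The weight t meets only the own class, through y_i + x_i.\<close>

lemma sum_mid_coef:
  "(\<Sum>r<5. mid_coef i t t ! r * diff_coef ! r * [D, y0, y1, x0, x1] ! r) =
    (if i = 0 then (D - (y0 + x0) + (y1 + x1)) / 2 + t * (y0 + x0)
     else - (D + (y0 + x0) - (y1 + x1)) / 2 - t * (y1 + x1))"
  by (simp add: sum_lessThan_5 mid_coef_def diff_coef_def field_simps)

section \<open>The asymptotic regime\<close>

text \<open>After whitening the errors see the prior means only through their difference, so one
  limit D is enough here. The threshold c may be any real number; its logarithmic value is inserted
  at the end.\<close>

locale lda_regime =
  fixes Sig :: "nat \<Rightarrow> nat \<Rightarrow> nat \<Rightarrow> real" and n :: "nat \<Rightarrow> nat \<Rightarrow> nat" and nu :: "nat \<Rightarrow> nat \<Rightarrow> real"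
    and m :: "nat \<Rightarrow> nat \<Rightarrow> nat \<Rightarrow> real" and J gam :: "nat \<Rightarrow> real" and c D :: real
  assumes Sig_spd: "\<And>p. sym_pd p (Sig p)"
    and nu_pos: "\<And>i p. i \<in> {0,1} \<Longrightarrow> nu p i > 0"
    and n_inf: "\<And>i. i \<in> {0,1} \<Longrightarrow> filterlim (\<lambda>p. real (n p i)) at_top sequentially"
    and nu_inf: "\<And>i. i \<in> {0,1} \<Longrightarrow> filterlim (\<lambda>p. nu p i) at_top sequentially"
    and J_lim: "\<And>i. i \<in> {0,1} \<Longrightarrow> (\<lambda>p. real p / real (n p i)) \<longlonglongrightarrow> J i"
    and gam_pos: "\<And>i. i \<in> {0,1} \<Longrightarrow> gam i > 0"
    and gam_lim: "\<And>i. i \<in> {0,1} \<Longrightarrow> (\<lambda>p. nu p i / real (n p i)) \<longlonglongrightarrow> gam i"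
    and D_lim: "(\<lambda>p. bil p (mat_inv p (Sig p)) (\<lambda>k. m p 0 k - m p 1 k) (\<lambda>k. m p 0 k - m p 1 k)) \<longlonglongrightarrow> D"
    and F_pos: "D + J 0 + J 1 + J 0 / gam 0 + J 1 / gam 1 > 0"
begin

definition "F = D + J 0 + J 1 + J 0 / gam 0 + J 1 / gam 1"

definition "H i = (if i = 0 then (D + J 1 - J 0 + J 0 / gam 0 + J 1 / gam 1) / 2
                   else - (D + J 0 - J 1 + J 0 / gam 0 + J 1 / gam 1) / 2)" for i :: nat

definition "err_lim i = Phi ((-1) ^ i * (- H i + c) / sqrt F)" for i :: nat

definition "K p = (SOME K. lower_tri p K \<and> whitens p K (Sig p))"

lemma K: "lower_tri p (K p)" "whitens p (K p) (Sig p)"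
proof -
  have "\<exists>K. lower_tri p K \<and> whitens p K (Sig p)"
    using ex_whitening[OF Sig_spd] by metis
  then have "lower_tri p (K p) \<and> whitens p (K p) (Sig p)"
    unfolding K_def by (rule someI_ex)
  then show "lower_tri p (K p)" "whitens p (K p) (Sig p)" by auto
qed

definition "u p = mat_app p (K p) (\<lambda>j. m p 0 j - m p 1 j)"

abbreviation "V p z \<equiv> vecs (u p) z"

abbreviation "M p \<equiv> whitened p (n p) (nu p)"

text \<open>Limits of the squared norms of the five vectors; J_i / gam_i arises as the limit of p /
  nu_i = (p / n_i) / (nu_i / n_i).\<close>

abbreviation "ell \<equiv> [D, J 0 / gam 0, J 1 / gam 1, J 0, J 1]"

lemma n_pos: "\<forall>\<^sub>F p in sequentially. 0 < n p 0 \<and> 0 < n p 1"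
proof -
  have pos: "\<forall>\<^sub>F p in sequentially. 0 < real (n p i)" if "i \<in> {0,1}" for i
    using n_inf[OF that, unfolded filterlim_at_top_dense] by blast
  have "\<forall>\<^sub>F p in sequentially. 0 < real (n p 0)" "\<forall>\<^sub>F p in sequentially. 0 < real (n p 1)"
    by (rule pos, simp)+
  then show ?thesis by eventually_elim simp
qed

text \<open>The law of the whitened sample means is available for positive sample sizes and positive
  dimension; the finitely many other indices do not affect limits.\<close>

lemma eventually_regular:
  "\<forall>\<^sub>F p in sequentially. (0 < nu p 0 \<and> 0 < nu p 1 \<and> 0 < n p 0 \<and> 0 < n p 1) \<and> 0 < p"
  using n_pos eventually_gt_at_top[of 0] by eventually_elim (simp add: nu_pos)

lemma tendsto_dot_V:
  assumes "r < 5" "q < 5"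
  shows "((\<lambda>z. dot (fst z) (V (fst z) (snd z) r) (V (fst z) (snd z) q)) \<longlongrightarrow> (if r = q then ell ! r else 0)) (in_prob M)"
proof (rule tendsto_dot_vecs)
  show "\<forall>\<^sub>F p in sequentially. 0 < nu p 0 \<and> 0 < nu p 1 \<and> 0 < n p 0 \<and> 0 < n p 1"
    using eventually_regular by eventually_elim simp
  show "(\<lambda>p. dot p (u p) (u p)) \<longlonglongrightarrow> ell ! 0"
    using D_lim unfolding bil_mat_inv[OF K] by (simp add: u_def mat_app_def dot_def)
  show "filterlim (\<lambda>p. precision (n p) (nu p) r) at_top sequentially" if "0 < r" "r < 5" for r
    using that(2,1) n_inf nu_inf by (cases rule: less_5_cases) (simp_all add: precision_def)
  have nu_lim: "(\<lambda>p. real p / nu p i) \<longlonglongrightarrow> J i / gam i" if "i \<in> {0,1}" for i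
  proof (rule Lim_transform_eventually)
    show "(\<lambda>p. (real p / real (n p i)) / (nu p i / real (n p i))) \<longlonglongrightarrow> J i / gam i"
      using gam_pos[OF that] by (intro tendsto_divide J_lim gam_lim that) simp
    show "\<forall>\<^sub>F p in sequentially. (real p / real (n p i)) / (nu p i / real (n p i)) = real p / nu p i"
      using n_pos by eventually_elim (use that in auto)
  qed
  show "(\<lambda>p. real p / precision (n p) (nu p) r) \<longlonglongrightarrow> ell ! r" if "0 < r" "r < 5" for r
    using that(2,1) nu_lim J_lim by (cases rule: less_5_cases) (simp_all add: precision_def)
qed fact+

lemma tendsto_comb_dot:
  assumes "\<And>r. r < 5 \<Longrightarrow> (\<lambda>p. a p ! r) \<longlonglongrightarrow> A ! r" "\<And>r. r < 5 \<Longrightarrow> (\<lambda>p. b p ! r) \<longlonglongrightarrow> B ! r"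
  shows "((\<lambda>z. comb_dot (fst z) (V (fst z) (snd z)) (a (fst z)) (b (fst z))) \<longlongrightarrow> (\<Sum>r<5. A ! r * B ! r * ell ! r)) (in_prob M)"
  unfolding comb_dot_def
  by (rule tendsto_dot_combinations[OF tendsto_dot_V]) (auto intro!: tendsto_in_prob_fst assms)

definition "shrink p i = real (n p i) / (real (n p i) + nu p i)"

definition "errT i p z = Phi (((-1) ^ (i + 1) * comb_dot p (V p z) (mid_coef i 1 0) diff_coef + (-1) ^ i * c)
    / sqrt (comb_dot p (V p z) diff_coef diff_coef))" for i

definition "errB i p z = Phi ((-1) ^ i * (- comb_dot p (V p z) (mid_coef i (shrink p i) (shrink p i)) diff_coef + c)
    / sqrt (comb_dot p (V p z) diff_coef diff_coef) * sqrt ((real (n p i) + nu p i) / (real (n p i) + nu p i + 1)))" for i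

lemma tendsto_delta: "((\<lambda>z. comb_dot (fst z) (V (fst z) (snd z)) diff_coef diff_coef) \<longlongrightarrow> F) (in_prob M)"
  using tendsto_comb_dot[of "\<lambda>_. diff_coef" diff_coef "\<lambda>_. diff_coef" diff_coef]
  by (simp add: sum_lessThan_5 diff_coef_def F_def add_ac)

lemma tendsto_errT:
  assumes i: "i \<in> {0,1}"
  shows "((\<lambda>z. errT i (fst z) (snd z)) \<longlongrightarrow> err_lim i) (in_prob M)"
proof -
  have "(\<Sum>r<5. mid_coef i 1 0 ! r * diff_coef ! r * ell ! r) = H i"
    using i by (auto simp: sum_lessThan_5 mid_coef_def diff_coef_def H_def field_simps)
  with tendsto_comb_dot[of "\<lambda>_. mid_coef i 1 0" "mid_coef i 1 0" "\<lambda>_. diff_coef" diff_coef]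
  have "((\<lambda>z. comb_dot (fst z) (V (fst z) (snd z)) (mid_coef i 1 0) diff_coef) \<longlongrightarrow> H i) (in_prob M)"
    by simp
  then have "((\<lambda>z. errT i (fst z) (snd z)) \<longlongrightarrow> Phi (((-1) ^ (i + 1) * H i + (-1) ^ i * c) / sqrt F)) (in_prob M)"
    unfolding errT_def using F_pos tendsto_delta
    by (intro isCont_tendsto_compose[OF isCont_Phi] tendsto_intros) (auto simp: F_def)
  moreover have "(-1) ^ (i + 1) * H i + (-1) ^ i * c = (-1) ^ i * (- H i + c)"
    by (simp add: algebra_simps)
  ultimately show ?thesis by (simp add: err_lim_def)
qed

lemma tendsto_shrink:
  assumes i: "i \<in> {0,1}"
  shows "(\<lambda>p. shrink p i) \<longlonglongrightarrow> 1 / (1 + gam i)"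
proof (rule Lim_transform_eventually)
  show "(\<lambda>p. 1 / (1 + nu p i / real (n p i))) \<longlonglongrightarrow> 1 / (1 + gam i)"
    using gam_pos[OF i] by (intro tendsto_intros gam_lim i) simp
  show "\<forall>\<^sub>F p in sequentially. 1 / (1 + nu p i / real (n p i)) = shrink p i"
    using n_pos by eventually_elim (use i in \<open>auto simp: shrink_def divide_simps\<close>)
qed

lemma tendsto_certainty_ratio:
  assumes i: "i \<in> {0,1}"
  shows "(\<lambda>p. (real (n p i) + nu p i) / (real (n p i) + nu p i + 1)) \<longlonglongrightarrow> 1"
proof -
  have pos: "0 < real (n p i) + nu p i + 1" for p
    using nu_pos[OF i, of p] by simp
  have "filterlim (\<lambda>p. real (n p i) + nu p i + 1) at_top sequentially"
    by (rule filterlim_at_top_mono[OF n_inf[OF i]])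
      (use nu_pos[OF i] in \<open>auto intro!: always_eventually simp: add_nonneg_nonneg less_imp_le add.assoc\<close>)
  from tendsto_diff[OF tendsto_const[of 1] tendsto_inverse_0_at_top[OF this]]
  have "(\<lambda>p. 1 - inverse (real (n p i) + nu p i + 1)) \<longlonglongrightarrow> 1" by simp
  moreover have "1 - inverse (real (n p i) + nu p i + 1) = (real (n p i) + nu p i) / (real (n p i) + nu p i + 1)" for p
    using pos[of p] by (simp add: field_simps)
  ultimately show ?thesis by simp
qed

lemma tendsto_errB:
  assumes i: "i \<in> {0,1}"
  shows "((\<lambda>z. errB i (fst z) (snd z)) \<longlongrightarrow> err_lim i) (in_prob M)"
proof -
  define t where "t = 1 / (1 + gam i)"
  \<comment> \<open>This identity is where the estimator meets the true error. Besides a common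
    term, the own class contributes t (J_i / gam_i + J_i) to the estimator and J_i / gam_i to the
    true error.\<close>
  have t: "t * (J i / gam i + J i) = J i / gam i"
  proof -
    have "J i / gam i + J i = J i / gam i * (1 + gam i)" "1 + gam i \<noteq> 0"
      using gam_pos[OF i] by (auto simp: field_simps)
    then show ?thesis by (simp only: t_def) simp
  qed
  have "(\<Sum>r<5. mid_coef i t t ! r * diff_coef ! r * ell ! r) = H i"
  proof (cases "i = 0")
    case True
    show ?thesis
      unfolding sum_mid_coef H_def if_P[OF True] using t[unfolded True] by argo
  next
    case False
    with i have "i = 1" by simp
    show ?thesis
      unfolding sum_mid_coef H_def if_not_P[OF False] using t[unfolded \<open>i = 1\<close>] by argo
  qed
  moreover have "(\<lambda>p. mid_coef i (shrink p i) (shrink p i) ! r) \<longlonglongrightarrow> mid_coef i t t ! r" if "r < 5" for r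
  proof -
    have s: "(\<lambda>p. shrink p i) \<longlonglongrightarrow> t"
      using tendsto_shrink[OF i] by (simp add: t_def)
    have s': "(\<lambda>p. shrink p i - 1/2) \<longlonglongrightarrow> t - 1/2"
      by (intro tendsto_intros s)
    show ?thesis
      using that s' by (cases rule: less_5_cases) (cases "i = 0"; simp add: mid_coef_def)+
  qed
  ultimately have "((\<lambda>z. comb_dot (fst z) (V (fst z) (snd z)) (mid_coef i (shrink (fst z) i) (shrink (fst z) i)) diff_coef) \<longlongrightarrow> H i) (in_prob M)"
    using tendsto_comb_dot[of "\<lambda>p. mid_coef i (shrink p i) (shrink p i)" "mid_coef i t t" "\<lambda>_. diff_coef" diff_coef] by simp
  then have "((\<lambda>z. errB i (fst z) (snd z)) \<longlongrightarrow> Phi ((-1) ^ i * (- H i + c) / sqrt F * sqrt 1)) (in_prob M)"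
    unfolding errB_def using F_pos tendsto_delta tendsto_in_prob_fst[OF tendsto_certainty_ratio[OF i], of M]
    by (intro isCont_tendsto_compose[OF isCont_Phi] tendsto_intros) (auto simp: F_def)
  then show ?thesis by (simp add: err_lim_def)
qed

lemma err_measurable:
  assumes "0 < nu p 0 \<and> 0 < nu p 1 \<and> 0 < n p 0 \<and> 0 < n p 1"
  shows "errT i p \<in> borel_measurable (M p)" "errB i p \<in> borel_measurable (M p)"
proof -
  have [measurable]: "(\<lambda>z. comb_dot p (V p z) a b) \<in> borel_measurable (M p)" for a b
    using assms by (intro comb_dot_vecs_measurable) auto
  show "errT i p \<in> borel_measurable (M p)" "errB i p \<in> borel_measurable (M p)"
    unfolding errT_def[abs_def] errB_def[abs_def] by measurable
qed

text \<open>The passage from convergence in probability to convergence of expectations: the nested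
  integral agrees with the integral over the whitened law for large p, and bounded convergence
  applies there.\<close>

lemma tendsto_joint_exp:
  fixes G :: "nat \<Rightarrow> (nat \<Rightarrow> real) \<times> (nat \<Rightarrow> real) \<times> (nat \<Rightarrow> real) \<times> (nat \<Rightarrow> real) \<Rightarrow> real"
  assumes G: "((\<lambda>z. G (fst z) (snd z)) \<longlongrightarrow> L) (in_prob M)"
    and meas: "\<And>p. 0 < nu p 0 \<and> 0 < nu p 1 \<and> 0 < n p 0 \<and> 0 < n p 1 \<Longrightarrow> G p \<in> borel_measurable (M p)"
    and B: "\<And>p z. \<bar>G p z\<bar> \<le> B"
    and g: "\<And>p mu0 mu1 x0 x1. g p mu0 mu1 x0 x1 = G p
      (mat_app p (K p) (\<lambda>j. mu0 j - m p 0 j), mat_app p (K p) (\<lambda>j. mu1 j - m p 1 j),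
       mat_app p (K p) (\<lambda>j. x0 j - mu0 j), mat_app p (K p) (\<lambda>j. x1 j - mu1 j))"
  shows "(\<lambda>p. joint_exp p (Sig p) (n p) (nu p) (m p) (g p)) \<longlonglongrightarrow> L"
proof (rule Lim_transform_eventually)
  have "\<forall>\<^sub>F p in sequentially. prob_space (M p) \<and> (\<lambda>\<omega>. G (fst (p, \<omega>)) (snd (p, \<omega>))) \<in> borel_measurable (M p)"
    using eventually_regular by eventually_elim (auto intro!: prob_space_whitened meas)
  from tendsto_integral_in_prob[OF G this B]
  show "(\<lambda>p. \<integral>z. G p z \<partial>M p) \<longlonglongrightarrow> L" by simp
  show "\<forall>\<^sub>F p in sequentially. (\<integral>z. G p z \<partial>M p) = joint_exp p (Sig p) (n p) (nu p) (m p) (g p)"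
    using eventually_regular
  proof eventually_elim
    case (elim p)
    then show ?case
      by (intro joint_exp_whitened[OF K, symmetric, where B = B] meas B g) auto
  qed
qed

section \<open>Joint moments of errors and estimators\<close>

abbreviation "eps p i mu0 mu1 xb0 xb1 \<equiv> true_err p (mat_inv p (Sig p)) c i (if i = 0 then mu0 else mu1) xb0 xb1"
abbreviation "epsB p i mu0 mu1 xb0 xb1 \<equiv> bayes_err p (mat_inv p (Sig p)) c i (n p i) (nu p i) (m p i) xb0 xb1"

lemma eps_whitened:
  "eps p i mu0 mu1 x0 x1 = errT i p
      (mat_app p (K p) (\<lambda>j. mu0 j - m p 0 j), mat_app p (K p) (\<lambda>j. mu1 j - m p 1 j),
       mat_app p (K p) (\<lambda>j. x0 j - mu0 j), mat_app p (K p) (\<lambda>j. x1 j - mu1 j))"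
  unfolding true_err_def Let_def increment_true[of i mu0 mu1 x0 x1 "m p"] increment_diff[of x0 x1 "m p" mu0 mu1]
    bil_increment[OF K] errT_def u_def ..

lemma epsB_whitened:
  assumes i: "i \<in> {0,1}"
  shows "epsB p i mu0 mu1 x0 x1 = errB i p
      (mat_app p (K p) (\<lambda>j. mu0 j - m p 0 j), mat_app p (K p) (\<lambda>j. mu1 j - m p 1 j),
       mat_app p (K p) (\<lambda>j. x0 j - mu0 j), mat_app p (K p) (\<lambda>j. x1 j - mu1 j))"
proof -
  have "0 < real (n p i) + nu p i" "i = 0 \<or> i = 1"
    using nu_pos[OF i, of p] i by (auto simp: add_nonneg_pos)
  note eq = increment_bayes[OF this, of x0 x1 "m p" mu0 mu1]
  show ?thesis
    unfolding bayes_err_def Let_def eq increment_diff[of x0 x1 "m p" mu0 mu1]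
      bil_increment[OF K] errB_def u_def shrink_def ..
qed

lemma err_bounds: "\<bar>errT i p z\<bar> \<le> 1" "\<bar>errB i p z\<bar> \<le> 1"
  using Phi_bounds by (simp_all add: errT_def errB_def)

text \<open>Since every factor below tends in probability to a constant, a product tends to the
  product of the constants; boundedness by 1 transfers this to its expectation.\<close>

abbreviation "E p g \<equiv> joint_exp p (Sig p) (n p) (nu p) (m p) g"

lemma tendsto_moments:
  assumes i: "i \<in> {0,1}" and j: "j \<in> {0,1}"
  shows "(\<lambda>p. E p (\<lambda>mu0 mu1 xb0 xb1. epsB p i mu0 mu1 xb0 xb1 * eps p j mu0 mu1 xb0 xb1)) \<longlonglongrightarrow> err_lim i * err_lim j"
    and "(\<lambda>p. E p (\<lambda>mu0 mu1 xb0 xb1. epsB p i mu0 mu1 xb0 xb1 * epsB p j mu0 mu1 xb0 xb1)) \<longlonglongrightarrow> err_lim i * err_lim j"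
    and "(\<lambda>p. E p (\<lambda>mu0 mu1 xb0 xb1. eps p i mu0 mu1 xb0 xb1 * eps p j mu0 mu1 xb0 xb1)) \<longlonglongrightarrow> err_lim i * err_lim j"
proof -
  have b: "\<bar>x * y\<bar> \<le> 1" if "\<bar>x\<bar> \<le> 1" "\<bar>y\<bar> \<le> 1" for x y :: real
    using mult_mono[OF that] by (simp add: abs_mult)
  note ms = borel_measurable_times err_measurable
  show "(\<lambda>p. E p (\<lambda>mu0 mu1 xb0 xb1. epsB p i mu0 mu1 xb0 xb1 * eps p j mu0 mu1 xb0 xb1)) \<longlonglongrightarrow> err_lim i * err_lim j"
    by (rule tendsto_joint_exp[where G = "\<lambda>p z. errB i p z * errT j p z" and B = 1])
      (intro tendsto_mult tendsto_errB tendsto_errT i j ms b err_bounds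
        arg_cong2[where f = "(*)"] eps_whitened epsB_whitened; assumption)+
  show "(\<lambda>p. E p (\<lambda>mu0 mu1 xb0 xb1. epsB p i mu0 mu1 xb0 xb1 * epsB p j mu0 mu1 xb0 xb1)) \<longlonglongrightarrow> err_lim i * err_lim j"
    by (rule tendsto_joint_exp[where G = "\<lambda>p z. errB i p z * errB j p z" and B = 1])
      (intro tendsto_mult tendsto_errB tendsto_errT i j ms b err_bounds
        arg_cong2[where f = "(*)"] eps_whitened epsB_whitened; assumption)+
  show "(\<lambda>p. E p (\<lambda>mu0 mu1 xb0 xb1. eps p i mu0 mu1 xb0 xb1 * eps p j mu0 mu1 xb0 xb1)) \<longlonglongrightarrow> err_lim i * err_lim j"
    by (rule tendsto_joint_exp[where G = "\<lambda>p z. errT i p z * errT j p z" and B = 1])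
      (intro tendsto_mult tendsto_errB tendsto_errT i j ms b err_bounds
        arg_cong2[where f = "(*)"] eps_whitened epsB_whitened; assumption)+
qed

text \<open>The whole product of weighted sums is treated as one bounded integrand. This avoids
  distributing the nested integral over the four terms, which would call for integrability at each
  level.\<close>

lemma tendsto_total_moment:
  "(\<lambda>p. E p (\<lambda>mu0 mu1 xb0 xb1.
      (\<Sum>i\<in>{0,1}. alpha i * epsB p i mu0 mu1 xb0 xb1) * (\<Sum>j\<in>{0,1}. alpha j * eps p j mu0 mu1 xb0 xb1)))
    \<longlonglongrightarrow> (\<Sum>i\<in>{0,1}. \<Sum>j\<in>{0,1}. alpha i * alpha j * (err_lim i * err_lim j))"
proof (rule tendsto_joint_exp)
  let ?G = "\<lambda>p z. (\<Sum>i\<in>{0,1}. alpha i * errB i p z) * (\<Sum>j\<in>{0,1}. alpha j * errT j p z)"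
  have "((\<lambda>z. ?G (fst z) (snd z)) \<longlongrightarrow> (\<Sum>i\<in>{0,1}. alpha i * err_lim i) * (\<Sum>j\<in>{0,1}. alpha j * err_lim j)) (in_prob M)"
    by (intro tendsto_mult tendsto_sum tendsto_const tendsto_errB tendsto_errT)
  also have "(\<Sum>i\<in>{0,1}. alpha i * err_lim i) * (\<Sum>j\<in>{0,1}. alpha j * err_lim j) =
      (\<Sum>i\<in>{0,1}. \<Sum>j\<in>{0,1}. alpha i * alpha j * (err_lim i * err_lim j))"
    by (simp only: sum_product mult_ac)
  finally show "((\<lambda>z. ?G (fst z) (snd z)) \<longlongrightarrow> (\<Sum>i\<in>{0,1}. \<Sum>j\<in>{0,1}. alpha i * alpha j * (err_lim i * err_lim j))) (in_prob M)" .
  show "?G p \<in> borel_measurable (M p)" if "0 < nu p 0 \<and> 0 < nu p 1 \<and> 0 < n p 0 \<and> 0 < n p 1" for p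
    using err_measurable[OF that] by (intro borel_measurable_times borel_measurable_sum borel_measurable_const)
  have b: "\<bar>\<Sum>i\<in>{0,1}. alpha i * f i\<bar> \<le> (\<Sum>i\<in>{0,1}. \<bar>alpha i\<bar>)" if "\<And>i. \<bar>f i\<bar> \<le> 1" for f :: "nat \<Rightarrow> real"
  proof -
    have "\<bar>alpha i * f i\<bar> \<le> \<bar>alpha i\<bar>" for i
      using that[of i] by (simp add: abs_mult mult_left_le)
    then show ?thesis by (intro order.trans[OF sum_abs] sum_mono)
  qed
  show "\<bar>?G p z\<bar> \<le> (\<Sum>i\<in>{0,1}. \<bar>alpha i\<bar>) * (\<Sum>i\<in>{0,1}. \<bar>alpha i\<bar>)" for p z
    unfolding abs_mult by (intro mult_mono b err_bounds sum_nonneg) auto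
qed (intro arg_cong2[where f = "(*)"] sum.cong refl eps_whitened epsB_whitened; assumption)

end

theorem theorem6:
  fixes alpha0 :: real
    and Sig :: "nat \<Rightarrow> nat \<Rightarrow> nat \<Rightarrow> real"
    and n :: "nat \<Rightarrow> nat \<Rightarrow> nat"
    and nu :: "nat \<Rightarrow> nat \<Rightarrow> real"
    and m :: "nat \<Rightarrow> nat \<Rightarrow> nat \<Rightarrow> real"
    and J gam :: "nat \<Rightarrow> real"
  assumes alpha0: "0 < alpha0" "alpha0 < 1"
    and Sig_spd: "\<And>p. sym_pd p (Sig p)"
    and nu_pos: "\<And>i p. i \<in> {0,1} \<Longrightarrow> nu p i > 0"
    and n_inf: "\<And>i. i \<in> {0,1} \<Longrightarrow> filterlim (\<lambda>p. real (n p i)) at_top sequentially"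
    and nu_inf: "\<And>i. i \<in> {0,1} \<Longrightarrow> filterlim (\<lambda>p. nu p i) at_top sequentially"
    and J_nonneg: "\<And>i. i \<in> {0,1} \<Longrightarrow> J i \<ge> 0"
    and J_lim: "\<And>i. i \<in> {0,1} \<Longrightarrow> (\<lambda>p. real p / real (n p i)) \<longlonglongrightarrow> J i"
    and gam_pos: "\<And>i. i \<in> {0,1} \<Longrightarrow> gam i > 0"
    and gam_lim: "\<And>i. i \<in> {0,1} \<Longrightarrow> (\<lambda>p. nu p i / real (n p i)) \<longlonglongrightarrow> gam i"
    and m_conv: "\<And>i j. i \<in> {0,1} \<Longrightarrow> j \<in> {0,1} \<Longrightarrow>
                   convergent (\<lambda>p. bil p (mat_inv p (Sig p)) (m p i) (m p j))"
    and F_pos: "let Dbar = lim (\<lambda>p. bil p (mat_inv p (Sig p)) (\<lambda>k. m p 0 k - m p 1 k) (\<lambda>k. m p 0 k - m p 1 k))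
                in Dbar + J 0 + J 1 + J 0 / gam 0 + J 1 / gam 1 > 0"
  shows "let alpha = (\<lambda>i::nat. if i = 0 then alpha0 else 1 - alpha0);
             c = ln ((1 - alpha0) / alpha0);
             Dbar = lim (\<lambda>p. bil p (mat_inv p (Sig p)) (\<lambda>k. m p 0 k - m p 1 k) (\<lambda>k. m p 0 k - m p 1 k));
             H = (\<lambda>i::nat. if i = 0 then (Dbar + J 1 - J 0 + J 0 / gam 0 + J 1 / gam 1) / 2
                           else - (Dbar + J 0 - J 1 + J 0 / gam 0 + J 1 / gam 1) / 2);
             F = Dbar + J 0 + J 1 + J 0 / gam 0 + J 1 / gam 1;
             lim_val = (\<lambda>i j::nat. Phi ((-1) ^ i * (- H i + c) / sqrt F) * Phi ((-1) ^ j * (- H j + c) / sqrt F));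
             eps = (\<lambda>p i mu0 mu1 xb0 xb1. true_err p (mat_inv p (Sig p)) c i (if i = 0 then mu0 else mu1) xb0 xb1);
             epsB = (\<lambda>p i mu0 mu1 xb0 xb1. bayes_err p (mat_inv p (Sig p)) c i (n p i) (nu p i) (m p i) xb0 xb1);
             E = (\<lambda>p g. joint_exp p (Sig p) (n p) (nu p) (m p) g)
         in (\<forall>i\<in>{0,1}. \<forall>j\<in>{0,1}.
               (\<lambda>p. E p (\<lambda>mu0 mu1 xb0 xb1. epsB p i mu0 mu1 xb0 xb1 * eps p j mu0 mu1 xb0 xb1)) \<longlonglongrightarrow> lim_val i j
             \<and> (\<lambda>p. E p (\<lambda>mu0 mu1 xb0 xb1. epsB p i mu0 mu1 xb0 xb1 * epsB p j mu0 mu1 xb0 xb1)) \<longlonglongrightarrow> lim_val i j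
             \<and> (\<lambda>p. E p (\<lambda>mu0 mu1 xb0 xb1. eps p i mu0 mu1 xb0 xb1 * eps p j mu0 mu1 xb0 xb1)) \<longlonglongrightarrow> lim_val i j)
          \<and> (\<lambda>p. E p (\<lambda>mu0 mu1 xb0 xb1.
                 (\<Sum>i\<in>{0,1}. alpha i * epsB p i mu0 mu1 xb0 xb1) * (\<Sum>j\<in>{0,1}. alpha j * eps p j mu0 mu1 xb0 xb1)))
             \<longlonglongrightarrow> (\<Sum>i\<in>{0,1}. \<Sum>j\<in>{0,1}. alpha i * alpha j * lim_val i j)"
proof -
  define c where "c = ln ((1 - alpha0) / alpha0)"
  define D where "D = lim (\<lambda>p. bil p (mat_inv p (Sig p)) (\<lambda>k. m p 0 k - m p 1 k) (\<lambda>k. m p 0 k - m p 1 k))"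
  \<comment> \<open>\<open>lim\<close> denotes the limit only for a convergent sequence. Convergence
    follows by expanding the form of m_0 - m_1 bilinearly into the four forms that converge by
    assumption.\<close>
  have "convergent (\<lambda>p. bil p (mat_inv p (Sig p)) (\<lambda>k. m p 0 k - m p 1 k) (\<lambda>k. m p 0 k - m p 1 k))"
    unfolding bil_diff_left bil_diff_right by (intro convergent_diff m_conv) auto
  then have D_lim: "(\<lambda>p. bil p (mat_inv p (Sig p)) (\<lambda>k. m p 0 k - m p 1 k) (\<lambda>k. m p 0 k - m p 1 k)) \<longlonglongrightarrow> D"
    unfolding D_def by (simp only: convergent_LIMSEQ_iff)
  have F_pos': "D + J 0 + J 1 + J 0 / gam 0 + J 1 / gam 1 > 0"
    using F_pos unfolding Let_def D_def .
  interpret lda_regime Sig n nu m J gam c D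
    by unfold_locales
      (rule Sig_spd nu_pos n_inf nu_inf J_lim gam_pos gam_lim D_lim F_pos'; assumption)+
  show ?thesis
    unfolding Let_def c_def[symmetric] D_def[symmetric] H_def[symmetric] F_def[symmetric] err_lim_def[symmetric]
    by (intro conjI ballI tendsto_moments tendsto_total_moment)
qed

end
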